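(* For any subset $K$ of $I=\{1,\dots,p\}$: (i) $\widehat\xi_K^{(n)}$ converges almost surely to $\xi_K$ as $n\to+\infty$. (ii) There exist, for $1\le m\le M$ and $1\le\ell\le q$, sequences of random operators $\big(\widehat\Lambda^{(n)}_{K|m}\big)_{n\in\mathbb N^*}$, $\big(\widehat\Phi^{(n)}_{\ell,K|m}\big)_{n\in\mathbb N^*}$ and $\big(\widehat\Psi^{(n)}_{\ell,K|m}\big)_{n\in\mathbb N^*}$ on $\mathcal E$ (with values in $\mathbb R$, $\mathbb R$ and $\mathbb R^p$ respectively) which converge almost surely uniformly to $\Lambda_{K|m}$, $\Phi_{\ell,K|m}$ and $\Psi_{\ell,K|m}$ respectively, such that $$n\widehat\xi_K^{(n)}=\sum_{m=1}^M\sqrt n\,\widehat\Lambda^{(n)}_{K|m}(\widehat W^{(n)})+\sum_{m=1}^M\sum_{\ell=1}^q\Big(p_m\widehat\Phi^{(n)}_{\ell,K|m}(\widehat W^{(n)})+p_mp_{\ell|m}\big\|\widehat\Psi^{(n)}_{\ell,K|m}(\widehat W^{(n)})+\sqrt n\,\Delta_{\ell,K|m}\big\|\Big)^2 .$$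
   Context: Setting. Let $(\Omega,\mathcal A,P)$ be a probability space, $X=(X^{(1)},\dots,X^{(p)})^T$ a random vector in $\mathbb R^p$ with $\mathbb E(\|X\|^4)<+\infty$ ($\|\cdot\|$ the Euclidean norm), $Y=(Y^{(1)},\dots,Y^{(d)})^T$ a random vector in $\{0,1\}^d$, and $Z$ a random variable with values in $\{1,\dots,q\}$, $q\ge 2$. Put $M=2^d$ and $U=1+\sum_{j=1}^d Y^{(j)}2^{j-1}\in\{1,\dots,M\}$. For $1\le \ell\le q$, $1\le m\le M$ put $p_m=P(U=m)$, $p_{\ell|m}=P(Z=\ell\mid U=m)$, $\mu_m=\mathbb E(X\mid U=m)$, $\mu_{\ell,m}=\mathbb E(X\mid Z=\ell,U=m)$; it is assumed that $p_m>0$ and $p_{\ell|m}>0$ for all $\ell,m$. For $u,v\in\mathbb R^p$, $u\otimes v$ is the linear map $h\mapsto\langle u,h\rangle v$, with $\langle\cdot,\cdot\rangle$ the Euclidean inner product. Put $V_m=\mathbb E\big((X-\mu_m)\otimes(X-\mu_m)\mid U=m\big)$, assumed invertible for every $m$. Criterion. Let $I=\{1,\dots,p\}$. For $K\subset I$ let $A_K:\mathbb R^p\to\mathbb R^{\mathrm{card}(K)}$, $x=(x_i)_{i\in I}\mapsto (x_i)_{i\in K}$, with adjoint $A_K^*$, and let $Q_{K|m}=A_K^*(A_KV_mA_K^* )^{-1}A_K$ (so $Q_{\varnothing|m}=0$). With $I_{\mathbb R^p}$ the identity operator, $$\xi_{K|m}=\sum_{\ell=1}^q p_{\ell|m}^2\,\big\|(I_{\mathbb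 R^p}-V_mQ_{K|m})(\mu_{\ell,m}-\mu_m)\big\|^2,\qquad \xi_K=\sum_{m=1}^M p_m^2\,\xi_{K|m}.$$ Estimators. Let $\{(X_i,Y_i,Z_i)\}_{1\le i\le n}$ be an i.i.d. sample of $(X,Y,Z)$, $U_i=1+\sum_{j=1}^dY_i^{(j)}2^{j-1}$, $\widehat N_m^{(n)}=\sum_{i=1}^n\mathbf 1_{\{U_i=m\}}$, $\widehat N_{\ell,m}^{(n)}=\sum_{i=1}^n\mathbf 1_{\{Z_i=\ell,U_i=m\}}$, and $$\widehat p_m^{(n)}=\frac{\widehat N_m^{(n)}}{n},\quad \widehat p_{\ell|m}^{(n)}=\frac{\widehat N_{\ell,m}^{(n)}}{\widehat N_m^{(n)}},\quad \widehat\mu_m^{(n)}=\frac1{\widehat N_m^{(n)}}\sum_{i=1}^n\mathbf 1_{\{U_i=m\}}X_i,\quad \widehat\mu_{\ell,m}^{(n)}=\frac1{\widehat N_{\ell,m}^{(n)}}\sum_{i=1}^n\mathbf 1_{\{Z_i=\ell,U_i=m\}}X_i,$$ $$\widehat V_m^{(n)}=\frac1{\widehat N_m^{(n)}}\sum_{i=1}^n\mathbf 1_{\{U_i=m\}}(X_i-\widehat\mu_m^{(n)})\otimes(X_i-\widehat\mu_m^{(n)}),\qquad \widehat Q_{K|m}^{(n)}=A_K^*(A_K\widehat V_m^{(n)}A_K^* )^{-1}A_K,$$ $$\widehat\xi_{K|m}^{(n)}=\sum_{\ell=1}^q(\widehat p_{\ell|m}^{(n)})^2\big\|(I_{\mathbb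 R^p}-\widehat V_m^{(n)}\widehat Q_{K|m}^{(n)})(\widehat\mu_{\ell,m}^{(n)}-\widehat\mu_m^{(n)})\big\|^2,\qquad \widehat\xi_K^{(n)}=\sum_{m=1}^M(\widehat p_m^{(n)})^2\,\widehat\xi_{K|m}^{(n)}.$$ Identities involving these estimators are understood whenever the estimators are defined (nonzero denominators, invertible $A_K\widehat V_m^{(n)}A_K^*$). The space $\mathcal E$ and $\widehat W^{(n)}$. Let $\mathcal L(\mathbb R^p)$ be the space of linear operators on $\mathbb R^p$, $\mathcal M_{r,s}(\mathbb R)$ the space of real $r\times s$ matrices, and $\mathcal E=\mathcal M_{qp,M}(\mathbb R)\times\mathbb R^{pM}\times\mathbb R^M\times\mathcal M_{q,M}(\mathbb R)\times\mathcal L(\mathbb R^p)^M$, a Euclidean space. An element $T=(a,b,c,d,e)\in\mathcal E$ is written in blocks $a=(a_{\ell,m})$ with $a_{\ell,m}\in\mathbb R^p$, $b=(b_m)$ with $b_m\in\mathbb R^p$, $c=(c_m)$ with $c_m\in\mathbb R$, $d=(d_{\ell,m})$ with $d_{\ell,m}\in\mathbb R$, $e=(e_m)$ with $e_m\in\mathcal L(\mathbb R^p)$ ($1\le\ell\le q$, $1\le m\le M$). Put $\pi_1^{\ell m}(T)=a_{\ell,m}$, $\pi_2^m(T)=b_m$, $\pi_3^m(T)=c_m$, $\pi_4^{\ell m}(T)=d_{\ell,m}$, $\pi_5^m(T)=e_m$. Let $\mathcal W$ be the $\mathcal E$-valued random variable whose blocks are $a_{\ell,m}=\mathbf 1_{\{Z=\ell,U=m\}}X$,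 $b_m=\mathbf 1_{\{U=m\}}X$, $c_m=\mathbf 1_{\{U=m\}}$, $d_{\ell,m}=\mathbf 1_{\{Z=\ell,U=m\}}$, $e_m=\mathbf 1_{\{U=m\}}X\otimes X$, and $\mathcal W_i$ the analogous variable with $(X,Z,U)$ replaced by $(X_i,Z_i,U_i)$. Put $\widehat W^{(n)}=\sqrt n\big(\frac1n\sum_{i=1}^n\mathcal W_i-\mathbb E(\mathcal W)\big)$. Limit operators. Put $\Delta_{\ell,K|m}=(I_{\mathbb R^p}-V_mQ_{K|m})(\mu_{\ell,m}-\mu_m)$ and, for $T\in\mathcal E$, $$\Lambda_{K|m}(T)=2p_m\pi_3^m(T)\,\xi_{K|m},\qquad \Phi_{\ell,K|m}(T)=p_m^{-1}\big(\pi_4^{\ell m}(T)-\pi_3^m(T)p_{\ell|m}\big)\|\Delta_{\ell,K|m}\|,$$ $$\begin{aligned}\Psi_{\ell,K|m}(T)=p_m^{-1}(I_{\mathbb R^p}-V_mQ_{K|m})\Big[&p_{\ell|m}^{-1}\big(\pi_1^{\ell m}(T)-\pi_4^{\ell m}(T)\mu_{\ell,m}\big)-\pi_2^m(T)+\pi_3^m(T)\mu_m\\&-\big(\pi_5^m(T)-\pi_3^m(T)(V_m+\mu_m\otimes\mu_m)\big)Q_{K|m}(\mu_{\ell,m}-\mu_m)\\&+\big((\pi_2^m(T)-\pi_3^m(T)\mu_m)\otimes\mu_m\big)Q_{K|m}(\mu_{\ell,m}-\mu_m)\\&+\big(\mu_m\otimes(\pi_2^m(T)-\pi_3^m(T)\mu_m)\big)Q_{K|m}(\mu_{\ell,m}-\mu_m)\Big].\end{aligned}$$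 "Random operators on $\mathcal E$" are random linear maps on $\mathcal E$; "almost surely uniformly" means almost sure convergence in the operator norm $\|T\|_\infty=\sup_{x\ne0}\|Tx\|/\|x\|$. *)

theory Defs
  imports "HOL-Probability.Probability"
begin

text \<open>\<open>'n idx\<close> is the set \<open>{1, \<dots>, CARD('n)}\<close>, made into a finite type so that it can index the
  coordinates of Euclidean spaces. With \<open>d = CARD('d)\<close> and \<open>q = CARD('q)\<close>, the index \<open>j\<close> has type
  \<open>'d idx\<close>, the index \<open>\<ell>\<close> has type \<open>'q idx\<close>, and, as \<open>CARD('d set) = 2 ^ CARD('d)\<close>, the index
  \<open>m \<in> {1, \<dots>, 2 ^ d}\<close> has type \<open>'d set idx\<close>.\<close>

typedef (overloaded) ('n::finite) idx = "{1..CARD('n)}"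
  morphisms nat_of_idx idx_of_nat
proof -
  have "0 < CARD('n)" by simp
  then have "1 \<in> {1..CARD('n)}" by (simp only: atLeastAtMost_iff) linarith
  then show ?thesis by blast
qed

lemma bij_betw_nat_of_idx: "bij_betw nat_of_idx (UNIV :: ('n::finite) idx set) {1..CARD('n)}"
  by (metis bij_betw_def inj_on_def nat_of_idx_inject type_definition.Rep_range
      type_definition_idx)

instance idx :: (finite) finite
proof
  show "finite (UNIV :: 'a idx set)"
    using bij_betw_finite[OF bij_betw_nat_of_idx[where 'n = 'a]] by simp
qed

lemma CARD_idx: "CARD(('n::finite) idx) = CARD('n)"
  using bij_betw_same_card[OF bij_betw_nat_of_idx[where 'n = 'n]] by simp

lemma CARD_set_idx: "CARD(('d::finite) set idx) = 2 ^ CARD('d)"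
  by (simp add: CARD_idx card_Pow flip: Pow_UNIV)

text \<open>\<open>1 + (\<Sum>j. y\<^sub>j 2\<^bsup>j-1\<^esup>)\<close>, where \<open>{0,1}\<^sup>d\<close> is \<open>bool ^ 'd idx\<close> and \<open>of_bool\<close> is the inclusion of
  \<open>{0,1}\<close> into the naturals. The lemma after it shows that \<open>idx_of_nat\<close> is applied within its
  domain only.\<close>

definition level :: "bool ^ ('d::finite) idx \<Rightarrow> 'd set idx" where
  "level y = idx_of_nat (1 + (\<Sum>j\<in>UNIV. of_bool (y $ j) * 2 ^ (nat_of_idx j - 1)))"

lemma nat_of_idx_level:
  "nat_of_idx (level (y :: bool ^ ('d::finite) idx))
    = 1 + (\<Sum>j\<in>UNIV. of_bool (y $ j) * 2 ^ (nat_of_idx j - 1))"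
proof -
  have geo: "(\<Sum>k=1..n. (2::nat) ^ (k - 1)) = 2 ^ n - 1" for n
    by (induction n) (auto simp: algebra_simps)
  have "(\<Sum>j\<in>UNIV. of_bool (y $ j) * 2 ^ (nat_of_idx j - 1))
      \<le> (\<Sum>j\<in>(UNIV :: 'd idx set). (2::nat) ^ (nat_of_idx j - 1))"
    by (intro sum_mono) auto
  also have "\<dots> = (\<Sum>k=1..CARD('d). 2 ^ (k - 1))"
    by (rule sum.reindex_bij_betw[OF bij_betw_nat_of_idx])
  also have "\<dots> = 2 ^ CARD('d) - 1"
    by (rule geo)
  finally have "(\<Sum>j\<in>UNIV. of_bool (y $ j) * 2 ^ (nat_of_idx j - 1)) \<le> (2::nat) ^ CARD('d) - 1" .
  moreover have "(1::nat) \<le> 2 ^ CARD('d)" by simp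
  moreover have "CARD('d set) = 2 ^ CARD('d)"
    by (simp add: card_Pow flip: Pow_UNIV)
  ultimately have "1 + (\<Sum>j\<in>UNIV. of_bool (y $ j) * 2 ^ (nat_of_idx j - 1)) \<in> {1..CARD('d set)}"
    by (simp only: atLeastAtMost_iff) linarith
  then show ?thesis
    unfolding level_def by (rule idx_of_nat_inverse)
qed

text \<open>A linear operator on \<open>\<real>\<^sup>p\<close> is given by its matrix in the canonical basis. Composition is \<open>**\<close>,
  evaluation is \<open>*v\<close>, and the norm of \<open>real ^ 'p ^ 'p\<close> is the Hilbert-Schmidt norm, for which the
  space of operators is Euclidean.\<close>

definition tensor :: "real ^ 'p \<Rightarrow> real ^ 'p \<Rightarrow> real ^ 'p ^ 'p" where
  "tensor u v = matrix (\<lambda>h. (u \<bullet> h) *\<^sub>R v)"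

lemma tensor_apply: "tensor u v *v h = (u \<bullet> h) *\<^sub>R v"
proof -
  have "linear (\<lambda>h. (u \<bullet> h) *\<^sub>R v)"
    by (auto intro!: linearI simp: inner_add_right scaleR_add_left)
  then show ?thesis
    unfolding tensor_def by (simp add: matrix_works)
qed

text \<open>\<open>\<real>\<^bsup>card K\<^esup>\<close> is the space of families \<open>(y\<^sub>i)\<^sub>i\<^sub>\<in>\<^sub>K\<close>; these are the extensional functions on \<open>K\<close>.
  Its inner product is \<open>\<Sum>i\<in>K. y\<^sub>i z\<^sub>i\<close>, and \<open>coord_adj K\<close> is the adjoint of \<open>coord K\<close>.\<close>

definition coord_space :: "'p set \<Rightarrow> ('p \<Rightarrow> real) set" where
  "coord_space K = K \<rightarrow>\<^sub>E UNIV"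

definition coord :: "'p set \<Rightarrow> real ^ 'p \<Rightarrow> 'p \<Rightarrow> real" where
  "coord K x = (\<lambda>i\<in>K. x $ i)"

definition coord_adj :: "'p set \<Rightarrow> ('p \<Rightarrow> real) \<Rightarrow> real ^ 'p" where
  "coord_adj K y = (\<chi> i. if i \<in> K then y i else 0)"

lemma coord_adj_adjoint: "(\<Sum>i\<in>K. coord K x i * y i) = x \<bullet> coord_adj K y"
  for K :: "('p::finite) set"
proof -
  have "x \<bullet> coord_adj K y = (\<Sum>i\<in>UNIV. if i \<in> K then x $ i * y i else 0)"
    unfolding inner_vec_def coord_adj_def by (intro sum.cong) auto
  also have "\<dots> = (\<Sum>i\<in>K. x $ i * y i)"
    by (simp add: sum.If_cases)
  finally show ?thesis
    by (simp add: coord_def)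
qed

definition compress :: "'p set \<Rightarrow> real ^ 'p ^ 'p \<Rightarrow> ('p \<Rightarrow> real) \<Rightarrow> 'p \<Rightarrow> real" where
  "compress K V = (\<lambda>y. coord K (V *v coord_adj K y))"

definition compress_invertible :: "'p set \<Rightarrow> real ^ 'p ^ 'p \<Rightarrow> bool" where
  "compress_invertible K V \<longleftrightarrow> bij_betw (compress K V) (coord_space K) (coord_space K)"

text \<open>\<open>A\<^sub>K\<^sup>* (A\<^sub>K V A\<^sub>K\<^sup>*)\<^sup>-\<^sup>1 A\<^sub>K\<close>; meaningful when \<open>compress_invertible K V\<close>.\<close>

definition Q_op :: "'p set \<Rightarrow> real ^ 'p ^ 'p \<Rightarrow> real ^ 'p ^ 'p" where
  "Q_op K V = matrix (\<lambda>x. coord_adj K (inv_into (coord_space K) (compress K V) (coord K x)))"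

lemma Q_op_empty: "Q_op {} V = 0"
  by (simp add: Q_op_def coord_adj_def matrix_def vec_eq_iff)

definition cexp :: "'a measure \<Rightarrow> ('a \<Rightarrow> bool) \<Rightarrow>
    ('a \<Rightarrow> 'b::{banach, second_countable_topology}) \<Rightarrow> 'b" where
  "cexp P A f = (1 / measure P {\<omega>\<in>space P. A \<omega>}) *\<^sub>R (LINT \<omega>:{\<omega>\<in>space P. A \<omega>}|P. f \<omega>)"

definition p_U :: "'a measure \<Rightarrow> ('a \<Rightarrow> 'm) \<Rightarrow> 'm \<Rightarrow> real" where
  "p_U P U m = measure P {\<omega>\<in>space P. U \<omega> = m}"

definition p_ZU :: "'a measure \<Rightarrow> ('a \<Rightarrow> 'm) \<Rightarrow> ('a \<Rightarrow> 'l) \<Rightarrow> 'l \<Rightarrow> 'm \<Rightarrow> real" where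
  "p_ZU P U Z l m = cond_prob P (\<lambda>\<omega>. Z \<omega> = l) (\<lambda>\<omega>. U \<omega> = m)"

definition mu_U :: "'a measure \<Rightarrow> ('a \<Rightarrow> real ^ 'p) \<Rightarrow> ('a \<Rightarrow> 'm) \<Rightarrow> 'm \<Rightarrow> real ^ 'p" where
  "mu_U P X U m = cexp P (\<lambda>\<omega>. U \<omega> = m) X"

definition mu_ZU :: "'a measure \<Rightarrow> ('a \<Rightarrow> real ^ 'p) \<Rightarrow> ('a \<Rightarrow> 'm) \<Rightarrow> ('a \<Rightarrow> 'l) \<Rightarrow>
    'l \<Rightarrow> 'm \<Rightarrow> real ^ 'p" where
  "mu_ZU P X U Z l m = cexp P (\<lambda>\<omega>. Z \<omega> = l \<and> U \<omega> = m) X"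

definition V_U :: "'a measure \<Rightarrow> ('a \<Rightarrow> real ^ 'p) \<Rightarrow> ('a \<Rightarrow> 'm) \<Rightarrow> 'm \<Rightarrow> real ^ 'p ^ 'p" where
  "V_U P X U m =
    cexp P (\<lambda>\<omega>. U \<omega> = m) (\<lambda>\<omega>. tensor (X \<omega> - mu_U P X U m) (X \<omega> - mu_U P X U m))"

definition Delta :: "'a measure \<Rightarrow> ('a \<Rightarrow> real ^ 'p) \<Rightarrow> ('a \<Rightarrow> 'm) \<Rightarrow> ('a \<Rightarrow> 'l) \<Rightarrow>
    'p set \<Rightarrow> 'l \<Rightarrow> 'm \<Rightarrow> real ^ 'p" where
  "Delta P X U Z K l m =
    (mat 1 - V_U P X U m ** Q_op K (V_U P X U m)) *v (mu_ZU P X U Z l m - mu_U P X U m)"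

definition xi_cond :: "'a measure \<Rightarrow> ('a \<Rightarrow> real ^ 'p) \<Rightarrow> ('a \<Rightarrow> 'm) \<Rightarrow> ('a \<Rightarrow> 'l::finite) \<Rightarrow>
    'p set \<Rightarrow> 'm \<Rightarrow> real" where
  "xi_cond P X U Z K m =
    (\<Sum>l\<in>UNIV. (p_ZU P U Z l m)\<^sup>2 *
      (norm ((mat 1 - V_U P X U m ** Q_op K (V_U P X U m)) *v
        (mu_ZU P X U Z l m - mu_U P X U m)))\<^sup>2)"

definition xi :: "'a measure \<Rightarrow> ('a \<Rightarrow> real ^ 'p) \<Rightarrow> ('a \<Rightarrow> 'm::finite) \<Rightarrow> ('a \<Rightarrow> 'l::finite) \<Rightarrow>
    'p set \<Rightarrow> real" where
  "xi P X U Z K = (\<Sum>m\<in>UNIV. (p_U P U m)\<^sup>2 * xi_cond P X U Z K m)"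

text \<open>The estimators are functions of the sample size \<open>n\<close> and of observed sequences \<open>x\<close>, \<open>u\<close>, \<open>z\<close>,
  of which only the terms with indices \<open>1, \<dots>, n\<close> are used.\<close>

definition N_U :: "nat \<Rightarrow> (nat \<Rightarrow> 'm) \<Rightarrow> 'm \<Rightarrow> real" where
  "N_U n u m = (\<Sum>i=1..n. of_bool (u i = m))"

definition N_ZU :: "nat \<Rightarrow> (nat \<Rightarrow> 'm) \<Rightarrow> (nat \<Rightarrow> 'l) \<Rightarrow> 'l \<Rightarrow> 'm \<Rightarrow> real" where
  "N_ZU n u z l m = (\<Sum>i=1..n. of_bool (z i = l \<and> u i = m))"

definition p_U_hat :: "nat \<Rightarrow> (nat \<Rightarrow> 'm) \<Rightarrow> 'm \<Rightarrow> real" where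
  "p_U_hat n u m = N_U n u m / real n"

definition p_ZU_hat :: "nat \<Rightarrow> (nat \<Rightarrow> 'm) \<Rightarrow> (nat \<Rightarrow> 'l) \<Rightarrow> 'l \<Rightarrow> 'm \<Rightarrow> real" where
  "p_ZU_hat n u z l m = N_ZU n u z l m / N_U n u m"

definition mu_U_hat :: "nat \<Rightarrow> (nat \<Rightarrow> real ^ 'p) \<Rightarrow> (nat \<Rightarrow> 'm) \<Rightarrow> 'm \<Rightarrow> real ^ 'p" where
  "mu_U_hat n x u m = (1 / N_U n u m) *\<^sub>R (\<Sum>i=1..n. of_bool (u i = m) *\<^sub>R x i)"

definition mu_ZU_hat :: "nat \<Rightarrow> (nat \<Rightarrow> real ^ 'p) \<Rightarrow> (nat \<Rightarrow> 'm) \<Rightarrow> (nat \<Rightarrow> 'l) \<Rightarrow>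
    'l \<Rightarrow> 'm \<Rightarrow> real ^ 'p" where
  "mu_ZU_hat n x u z l m =
    (1 / N_ZU n u z l m) *\<^sub>R (\<Sum>i=1..n. of_bool (z i = l \<and> u i = m) *\<^sub>R x i)"

definition V_U_hat :: "nat \<Rightarrow> (nat \<Rightarrow> real ^ 'p) \<Rightarrow> (nat \<Rightarrow> 'm) \<Rightarrow> 'm \<Rightarrow> real ^ 'p ^ 'p" where
  "V_U_hat n x u m =
    (1 / N_U n u m) *\<^sub>R
      (\<Sum>i=1..n. of_bool (u i = m) *\<^sub>R tensor (x i - mu_U_hat n x u m) (x i - mu_U_hat n x u m))"

definition xi_cond_hat :: "nat \<Rightarrow> (nat \<Rightarrow> real ^ 'p) \<Rightarrow> (nat \<Rightarrow> 'm) \<Rightarrow> (nat \<Rightarrow> 'l::finite) \<Rightarrow>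
    'p set \<Rightarrow> 'm \<Rightarrow> real" where
  "xi_cond_hat n x u z K m =
    (\<Sum>l\<in>UNIV. (p_ZU_hat n u z l m)\<^sup>2 *
      (norm ((mat 1 - V_U_hat n x u m ** Q_op K (V_U_hat n x u m)) *v
        (mu_ZU_hat n x u z l m - mu_U_hat n x u m)))\<^sup>2)"

definition xi_hat :: "nat \<Rightarrow> (nat \<Rightarrow> real ^ 'p) \<Rightarrow> (nat \<Rightarrow> 'm::finite) \<Rightarrow> (nat \<Rightarrow> 'l::finite) \<Rightarrow>
    'p set \<Rightarrow> real" where
  "xi_hat n x u z K = (\<Sum>m\<in>UNIV. (p_U_hat n u m)\<^sup>2 * xi_cond_hat n x u z K m)"

text \<open>All denominators are nonzero and all inverses exist, so that \<open>xi_hat\<close> does not involve any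
  conventional value.\<close>

definition estimators_defined :: "nat \<Rightarrow> (nat \<Rightarrow> real ^ 'p) \<Rightarrow> (nat \<Rightarrow> 'm) \<Rightarrow> (nat \<Rightarrow> 'l) \<Rightarrow>
    'p set \<Rightarrow> bool" where
  "estimators_defined n x u z K \<longleftrightarrow>
    n \<noteq> 0 \<and> (\<forall>m. N_U n u m \<noteq> 0) \<and> (\<forall>l m. N_ZU n u z l m \<noteq> 0) \<and>
    (\<forall>m. compress_invertible K (V_U_hat n x u m))"

type_synonym ('p, 'l, 'm) E_space =
  "((real ^ 'p) ^ 'm ^ 'l) \<times> ((real ^ 'p) ^ 'm) \<times> (real ^ 'm) \<times> (real ^ 'm ^ 'l) \<times> ((real ^ 'p ^ 'p) ^ 'm)"

definition pi1 :: "'l \<Rightarrow> 'm \<Rightarrow> ('p::finite, 'l::finite, 'm::finite) E_space \<Rightarrow> real ^ 'p" where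
  "pi1 l m T = (case T of (a, b, c, d, e) \<Rightarrow> a $ l $ m)"

definition pi2 :: "'m \<Rightarrow> ('p::finite, 'l::finite, 'm::finite) E_space \<Rightarrow> real ^ 'p" where
  "pi2 m T = (case T of (a, b, c, d, e) \<Rightarrow> b $ m)"

definition pi3 :: "'m \<Rightarrow> ('p::finite, 'l::finite, 'm::finite) E_space \<Rightarrow> real" where
  "pi3 m T = (case T of (a, b, c, d, e) \<Rightarrow> c $ m)"

definition pi4 :: "'l \<Rightarrow> 'm \<Rightarrow> ('p::finite, 'l::finite, 'm::finite) E_space \<Rightarrow> real" where
  "pi4 l m T = (case T of (a, b, c, d, e) \<Rightarrow> d $ l $ m)"

definition pi5 :: "'m \<Rightarrow> ('p::finite, 'l::finite, 'm::finite) E_space \<Rightarrow> real ^ 'p ^ 'p" where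
  "pi5 m T = (case T of (a, b, c, d, e) \<Rightarrow> e $ m)"

definition W_of :: "real ^ 'p \<Rightarrow> 'm \<Rightarrow> 'l \<Rightarrow> ('p::finite, 'l::finite, 'm::finite) E_space" where
  "W_of x u z =
    ((\<chi> l m. of_bool (z = l \<and> u = m) *\<^sub>R x),
     (\<chi> m. of_bool (u = m) *\<^sub>R x),
     (\<chi> m. of_bool (u = m)),
     (\<chi> l m. of_bool (z = l \<and> u = m)),
     (\<chi> m. of_bool (u = m) *\<^sub>R tensor x x))"

definition W_hat :: "'a measure \<Rightarrow> ('a \<Rightarrow> real ^ 'p) \<Rightarrow> ('a \<Rightarrow> 'm) \<Rightarrow> ('a \<Rightarrow> 'l) \<Rightarrow>
    nat \<Rightarrow> (nat \<Rightarrow> real ^ 'p) \<Rightarrow> (nat \<Rightarrow> 'm) \<Rightarrow> (nat \<Rightarrow> 'l) \<Rightarrow>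
    ('p::finite, 'l::finite, 'm::finite) E_space" where
  "W_hat P X U Z n x u z =
    sqrt (real n) *\<^sub>R ((1 / real n) *\<^sub>R (\<Sum>i=1..n. W_of (x i) (u i) (z i))
      - (LINT \<omega>|P. W_of (X \<omega>) (U \<omega>) (Z \<omega>)))"

definition random_operator ::
    "'a measure \<Rightarrow> ('a \<Rightarrow> 'b::euclidean_space \<Rightarrow> 'c::euclidean_space) \<Rightarrow> bool" where
  "random_operator P L \<longleftrightarrow>
    (\<forall>\<omega>\<in>space P. linear (L \<omega>)) \<and> (\<forall>T. (\<lambda>\<omega>. L \<omega> T) \<in> borel_measurable P)"

definition as_uniformly_converges ::
    "'a measure \<Rightarrow> (nat \<Rightarrow> 'a \<Rightarrow> 'b::euclidean_space \<Rightarrow> 'c::euclidean_space) \<Rightarrow>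
      ('b \<Rightarrow> 'c) \<Rightarrow> bool" where
  "as_uniformly_converges P Ls L \<longleftrightarrow>
    (AE \<omega> in P. (\<lambda>n. onorm (\<lambda>T. Ls n \<omega> T - L T)) \<longlonglongrightarrow> 0)"

definition Lambda_op :: "'a measure \<Rightarrow> ('a \<Rightarrow> real ^ 'p) \<Rightarrow> ('a \<Rightarrow> 'm) \<Rightarrow> ('a \<Rightarrow> 'l) \<Rightarrow>
    'p set \<Rightarrow> 'm \<Rightarrow> ('p::finite, 'l::finite, 'm::finite) E_space \<Rightarrow> real" where
  "Lambda_op P X U Z K m T = 2 * p_U P U m * pi3 m T * xi_cond P X U Z K m"

definition Phi_op :: "'a measure \<Rightarrow> ('a \<Rightarrow> real ^ 'p) \<Rightarrow> ('a \<Rightarrow> 'm) \<Rightarrow> ('a \<Rightarrow> 'l) \<Rightarrow>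
    'p set \<Rightarrow> 'l \<Rightarrow> 'm \<Rightarrow> ('p::finite, 'l::finite, 'm::finite) E_space \<Rightarrow> real" where
  "Phi_op P X U Z K l m T =
    inverse (p_U P U m) * (pi4 l m T - pi3 m T * p_ZU P U Z l m) * norm (Delta P X U Z K l m)"

definition Psi_op :: "'a measure \<Rightarrow> ('a \<Rightarrow> real ^ 'p) \<Rightarrow> ('a \<Rightarrow> 'm) \<Rightarrow> ('a \<Rightarrow> 'l) \<Rightarrow>
    'p set \<Rightarrow> 'l \<Rightarrow> 'm \<Rightarrow> ('p::finite, 'l::finite, 'm::finite) E_space \<Rightarrow> real ^ 'p" where
  "Psi_op P X U Z K l m T =
    (let p = p_U P U m; pl = p_ZU P U Z l m;
         mu = mu_U P X U m; mul = mu_ZU P X U Z l m;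
         V = V_U P X U m; Q = Q_op K V
     in inverse p *\<^sub>R ((mat 1 - V ** Q) *v
          (inverse pl *\<^sub>R (pi1 l m T - pi4 l m T *\<^sub>R mul)
           - pi2 m T + pi3 m T *\<^sub>R mu
           - ((pi5 m T - pi3 m T *\<^sub>R (V + tensor mu mu)) ** Q) *v (mul - mu)
           + (tensor (pi2 m T - pi3 m T *\<^sub>R mu) mu ** Q) *v (mul - mu)
           + (tensor mu (pi2 m T - pi3 m T *\<^sub>R mu) ** Q) *v (mul - mu))))"

end

theory Submission
  imports Defs "HOL-Library.Discrete_Functions"
begin

text \<open>All estimators are functions of one vector: the average \<open>W n\<close> of the \<open>n\<close> observations
  \<open>W_of X\<^sub>i U\<^sub>i Z\<^sub>i\<close> in \<open>\<E>\<close>. The population parameters are the same functions of the mean \<open>W_exp\<close> of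
  \<open>W_of X U Z\<close>. These functions carry the suffix \<open>_at\<close>: \<open>mean_at\<close>, \<open>cov_at\<close>, \<open>xi_at\<close>, and so on. Both
  claims then concern these functions near \<open>W_exp\<close>.

  Consistency. Since \<open>X\<close> has a fourth moment, \<open>W_of X U Z\<close> has a second moment, and a strong law of
  large numbers under a second moment gives \<open>W n \<rightarrow> W_exp\<close> almost surely
  (\<open>strong_law_iid_euclidean\<close>). The functions are continuous at \<open>W_exp\<close> because the denominators
  are positive there and each compression of \<open>V\<^sub>m\<close> to the coordinates in \<open>K\<close> is invertible: \<open>V\<^sub>m\<close> is a
  covariance and invertible, hence positive definite (\<open>V_U_positive_definite\<close>). The operator \<open>Q\<close> is
  the inverse of a full square matrix, composed with a coordinate projection
  (\<open>Q_op_eq_Q_padded\<close>). By Cramer's rule it depends continuously on \<open>V\<close> wherever that matrix is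
  invertible, and measurably everywhere.

  The decomposition. For regular points \<open>w\<close> and \<open>w\<^sub>0\<close> of \<open>\<E>\<close>, the increments of all the functions from
  \<open>w\<^sub>0\<close> to \<open>w\<close> are exactly linear in \<open>w - w\<^sub>0\<close> once coefficients may depend on \<open>w\<close>. For a ratio this
  is \<open>ratio_increment\<close>; for \<open>V Q\<close> it is the identity
  \<open>V' Q' - V Q = (I - V' Q') (V' - V) Q\<close>,
  which holds because \<open>Q' V Q = Q'\<close> and \<open>Q' V' Q = Q\<close> (\<open>oblique_projection_difference\<close>). This gives
  operators \<open>Lambda_at\<close>, \<open>Phi_at\<close>, \<open>Psi_at\<close>, linear in \<open>T \<in> \<E>\<close> and depending on \<open>w\<^sub>0\<close> and \<open>w\<close>, for which
  the decomposition is an algebraic identity at \<open>T = \<surd>n (w - w\<^sub>0)\<close> (\<open>xi_at_decomposition\<close>). At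
  \<open>w = w\<^sub>0 = W_exp\<close> they are the limit operators; at \<open>w = W n\<close> they are the random operators that the
  theorem asks for. Continuity in \<open>w\<close> gives their convergence at every \<open>T\<close>, which in finite
  dimension is convergence in operator norm (\<open>onorm_tendsto_zero_if_pointwise\<close>).\<close>

section \<open>A strong law of large numbers under a second moment\<close>

text \<open>Between two consecutive squares \<open>k\<^sup>2 \<le> n \<le> (k+1)\<^sup>2\<close>, monotonicity traps \<open>S n / n\<close> between the
  averages at these squares, up to factors \<open>(k/(k+1))\<^sup>2\<close> and \<open>((k+1)/k)\<^sup>2\<close> that tend to 1. A
  strong law for nonnegative summands therefore has to be checked along the squares only.\<close>

lemma tendsto_average_if_squares:
  fixes S :: "nat \<Rightarrow> real"
  assumes mono: "mono S" and nonneg: "\<And>n. 0 \<le> S n"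
    and squares: "(\<lambda>k. S (k\<^sup>2) / real (k\<^sup>2)) \<longlonglongrightarrow> \<mu>"
  shows "(\<lambda>n. S n / real n) \<longlonglongrightarrow> \<mu>"
proof -
  define low where "low k = S (k\<^sup>2) / real (k\<^sup>2) * (real k / real (Suc k))\<^sup>2" for k
  define upp where
    "upp k = S ((Suc k)\<^sup>2) / real ((Suc k)\<^sup>2) * (real (Suc k) / real k)\<^sup>2" for k
  have root: "filterlim floor_sqrt at_top at_top"
    unfolding filterlim_at_top
  proof (intro allI)
    fix Z :: nat
    show "eventually (\<lambda>x. Z \<le> floor_sqrt x) at_top"
      using eventually_ge_at_top[of "Z\<^sup>2"] by eventually_elim (simp add: le_floor_sqrt_iff)
  qed
  have ratio: "(\<lambda>k. real k / real (Suc k)) \<longlonglongrightarrow> 1"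
    by (rule LIMSEQ_n_over_Suc_n)
  have ratio': "(\<lambda>k. real (Suc k) / real k) \<longlonglongrightarrow> 1"
    by (rule LIMSEQ_Suc_n_over_n)
  have "low \<longlonglongrightarrow> \<mu> * 1\<^sup>2"
    unfolding low_def by (intro tendsto_intros squares ratio)
  then have lim_low: "(\<lambda>n. low (floor_sqrt n)) \<longlonglongrightarrow> \<mu>"
    using filterlim_compose[OF _ root, of low] by simp
  have "upp \<longlonglongrightarrow> \<mu> * 1\<^sup>2"
    unfolding upp_def by (intro tendsto_intros LIMSEQ_Suc[OF squares] ratio')
  then have lim_upp: "(\<lambda>n. upp (floor_sqrt n)) \<longlonglongrightarrow> \<mu>"
    using filterlim_compose[OF _ root, of upp] by simp
  have bounds: "low (floor_sqrt n) \<le> S n / real n \<and> S n / real n \<le> upp (floor_sqrt n)"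
    if n: "1 \<le> n" for n
  proof -
    let ?k = "floor_sqrt n"
    have k: "1 \<le> ?k"
      using n by (simp add: le_floor_sqrt_iff)
    have kn: "?k\<^sup>2 \<le> n"
      by simp
    have nk: "n \<le> (Suc ?k)\<^sup>2"
      using Suc_floor_sqrt_power2_gt[of n] by simp
    have "low ?k = S (?k\<^sup>2) / real ((Suc ?k)\<^sup>2)"
      using k by (simp add: low_def power_divide del: of_nat_Suc)
    also have "\<dots> \<le> S n / real n"
      using n kn nk monoD[OF mono kn] nonneg by (intro frac_le) (simp_all del: of_nat_power)
    finally have 1: "low ?k \<le> S n / real n" .
    have "S n / real n \<le> S ((Suc ?k)\<^sup>2) / real (?k\<^sup>2)"
      using n k kn nk monoD[OF mono nk] nonneg by (intro frac_le) (simp_all del: of_nat_power)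
    also have "\<dots> = upp ?k"
      using k by (simp add: upp_def power_divide del: of_nat_Suc)
    finally show ?thesis using 1 by simp
  qed
  show ?thesis
    by (rule tendsto_sandwich[OF _ _ lim_low lim_upp])
      (use bounds in \<open>auto intro!: eventually_sequentiallyI[of 1]\<close>)
qed

lemma integrable_mult_if_square_integrable:
  fixes f g :: "'a \<Rightarrow> real"
  assumes [measurable]: "f \<in> borel_measurable M" "g \<in> borel_measurable M"
    and f: "integrable M (\<lambda>x. (f x)\<^sup>2)" and g: "integrable M (\<lambda>x. (g x)\<^sup>2)"
  shows "integrable M (\<lambda>x. f x * g x)"
proof (rule Bochner_Integration.integrable_bound)
  show "integrable M (\<lambda>x. (f x)\<^sup>2 + (g x)\<^sup>2)"
    using f g by simp
  have "\<bar>a * b\<bar> \<le> a\<^sup>2 + b\<^sup>2" for a b :: real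
  proof -
    have "2 * (\<bar>a\<bar> * \<bar>b\<bar>) \<le> a\<^sup>2 + b\<^sup>2"
      using sum_squares_bound[of "\<bar>a\<bar>" "\<bar>b\<bar>"] by (simp add: mult.assoc)
    moreover have "0 \<le> \<bar>a\<bar> * \<bar>b\<bar>" by simp
    ultimately show ?thesis unfolding abs_mult by linarith
  qed
  then show "AE x in M. norm (f x * g x) \<le> norm ((f x)\<^sup>2 + (g x)\<^sup>2)"
    by simp
qed measurable

context prob_space
begin

lemma integrable_if_square_integrable:
  fixes f :: "'a \<Rightarrow> real"
  assumes "f \<in> borel_measurable M" "integrable M (\<lambda>x. (f x)\<^sup>2)"
  shows "integrable M f"
  using integrable_mult_if_square_integrable[of f M "\<lambda>_. 1"] assms by simp

text \<open>The off-diagonal covariances vanish, and each variance is at most the second moment.\<close>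

lemma second_moment_centered_sum_le:
  fixes f :: "nat \<Rightarrow> 'a \<Rightarrow> real"
  assumes meas: "\<And>i. i \<in> I \<Longrightarrow> f i \<in> borel_measurable M"
    and sq: "\<And>i. i \<in> I \<Longrightarrow> integrable M (\<lambda>x. (f i x)\<^sup>2)"
    and mean: "\<And>i. i \<in> I \<Longrightarrow> expectation (f i) = \<mu>"
    and second: "\<And>i. i \<in> I \<Longrightarrow> expectation (\<lambda>x. (f i x)\<^sup>2) \<le> C"
    and uncor: "\<And>i j. i \<in> I \<Longrightarrow> j \<in> I \<Longrightarrow> i \<noteq> j \<Longrightarrow> expectation (\<lambda>x. f i x * f j x) = \<mu>\<^sup>2"
    and fin: "finite I"
  shows "integrable M (\<lambda>x. (\<Sum>i\<in>I. f i x - \<mu>)\<^sup>2)"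
    and "expectation (\<lambda>x. (\<Sum>i\<in>I. f i x - \<mu>)\<^sup>2) \<le> real (card I) * C"
proof -
  have int: "integrable M (f i)" if "i \<in> I" for i
    using integrable_if_square_integrable meas sq that by blast
  have int2: "integrable M (\<lambda>x. f i x * f j x)" if "i \<in> I" "j \<in> I" for i j
    using integrable_mult_if_square_integrable meas sq that by blast
  have expand: "(\<Sum>i\<in>I. f i x - \<mu>)\<^sup>2
      = (\<Sum>i\<in>I. \<Sum>j\<in>I. f i x * f j x - \<mu> * f i x - \<mu> * f j x + \<mu>\<^sup>2)" for x
    unfolding power2_eq_square sum_product by (intro sum.cong refl) (simp add: algebra_simps)
  show "integrable M (\<lambda>x. (\<Sum>i\<in>I. f i x - \<mu>)\<^sup>2)"
    unfolding expand using int int2 by (auto intro!: Bochner_Integration.integrable_sum)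
  have term_eq: "expectation (\<lambda>x. f i x * f j x - \<mu> * f i x - \<mu> * f j x + \<mu>\<^sup>2)
      = expectation (\<lambda>x. f i x * f j x) - \<mu>\<^sup>2" if "i \<in> I" "j \<in> I" for i j
    using int int2 mean that by (simp add: prob_space power2_eq_square)
  have "expectation (\<lambda>x. (\<Sum>i\<in>I. f i x - \<mu>)\<^sup>2)
      = (\<Sum>i\<in>I. \<Sum>j\<in>I. expectation (\<lambda>x. f i x * f j x) - \<mu>\<^sup>2)"
    unfolding expand using int int2 term_eq
    by (subst Bochner_Integration.integral_sum, (auto intro!: Bochner_Integration.integrable_sum)[1],
        intro sum.cong refl)+ auto
  also have "\<dots> \<le> (\<Sum>i\<in>I. \<Sum>j\<in>I. if j = i then C else 0)"
  proof (intro sum_mono)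
    fix i j assume ij: "i \<in> I" "j \<in> I"
    show "expectation (\<lambda>x. f i x * f j x) - \<mu>\<^sup>2 \<le> (if j = i then C else 0)"
    proof (cases "j = i")
      case True
      then show ?thesis
        using second[OF ij(1)] by (simp flip: power2_eq_square)
          (meson diff_le_eq le_add_same_cancel1 order_trans zero_le_power2)
    next
      case False
      then show ?thesis using uncor[OF ij] by simp
    qed
  qed
  also have "\<dots> = real (card I) * C"
    using fin by (simp add: sum.delta)
  finally show "expectation (\<lambda>x. (\<Sum>i\<in>I. f i x - \<mu>)\<^sup>2) \<le> real (card I) * C" .
qed

text \<open>The sum of the \<open>h k\<close> has a finite integral, so the series converges almost everywhere.\<close>

lemma AE_tendsto_zero_if_summable_expectation:
  fixes h :: "nat \<Rightarrow> 'a \<Rightarrow> real"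
  assumes int: "\<And>k. integrable M (h k)" and nonneg: "\<And>k x. 0 \<le> h k x"
    and summable: "summable (\<lambda>k. expectation (h k))"
  shows "AE x in M. (\<lambda>k. h k x) \<longlonglongrightarrow> 0"
proof -
  have [measurable]: "h k \<in> borel_measurable M" for k
    using int by (rule borel_measurable_integrable)
  have "(\<integral>\<^sup>+x. (\<Sum>k. ennreal (h k x)) \<partial>M) = (\<Sum>k. \<integral>\<^sup>+x. ennreal (h k x) \<partial>M)"
    by (rule nn_integral_suminf) measurable
  also have "\<dots> = (\<Sum>k. ennreal (expectation (h k)))"
    using int nonneg by (intro suminf_cong nn_integral_eq_integral) auto
  also have "\<dots> \<noteq> \<infinity>"
    unfolding infinity_ennreal_def
    by (intro ennreal_suminf_neq_top summable integral_nonneg_AE) (simp add: nonneg)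
  finally have "AE x in M. (\<Sum>k. ennreal (h k x)) \<noteq> \<infinity>"
    by (intro nn_integral_PInf_AE) measurable
  then show ?thesis
  proof eventually_elim
    case (elim x)
    then have "summable (\<lambda>k. h k x)"
      unfolding infinity_ennreal_def by (rule summable_suminf_not_top[OF nonneg])
    then show ?case
      by (rule summable_LIMSEQ_zero)
  qed
qed

text \<open>The second moment of the centered average of \<open>n\<close> terms is of order \<open>1/n\<close>, which is summable
  along the squares but not along all \<open>n\<close>; nonnegativity makes up for the difference, since the
  partial sums are monotone.\<close>

lemma strong_law_nonneg_uncorrelated:
  fixes f :: "nat \<Rightarrow> 'a \<Rightarrow> real"
  assumes meas: "\<And>i. 1 \<le> i \<Longrightarrow> f i \<in> borel_measurable M"
    and nonneg: "\<And>i x. 0 \<le> f i x"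
    and sq: "\<And>i. 1 \<le> i \<Longrightarrow> integrable M (\<lambda>x. (f i x)\<^sup>2)"
    and mean: "\<And>i. 1 \<le> i \<Longrightarrow> expectation (f i) = \<mu>"
    and second: "\<And>i. 1 \<le> i \<Longrightarrow> expectation (\<lambda>x. (f i x)\<^sup>2) \<le> C"
    and uncor: "\<And>i j. 1 \<le> i \<Longrightarrow> 1 \<le> j \<Longrightarrow> i \<noteq> j \<Longrightarrow> expectation (\<lambda>x. f i x * f j x) = \<mu>\<^sup>2"
  shows "AE x in M. (\<lambda>n. (\<Sum>i=1..n. f i x) / real n) \<longlonglongrightarrow> \<mu>"
proof -
  define h where "h k x = ((\<Sum>i=1..(Suc k)\<^sup>2. f i x - \<mu>) / real ((Suc k)\<^sup>2))\<^sup>2" for k x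
  have h_sum: "integrable M (\<lambda>x. (\<Sum>i=1..n. f i x - \<mu>)\<^sup>2)"
      "expectation (\<lambda>x. (\<Sum>i=1..n. f i x - \<mu>)\<^sup>2) \<le> real n * C" for n
    using second_moment_centered_sum_le[of "{1..n}" f \<mu> C] assms by auto
  have h_int: "integrable M (h k)" for k
    unfolding h_def power_divide using h_sum(1) by simp
  have h_le: "expectation (h k) \<le> C * (1 / real ((Suc k)\<^sup>2))" for k
  proof -
    have "expectation (h k)
        = expectation (\<lambda>x. (\<Sum>i=1..(Suc k)\<^sup>2. f i x - \<mu>)\<^sup>2) / (real ((Suc k)\<^sup>2))\<^sup>2"
      unfolding h_def power_divide using h_sum(1) by simp
    also have "\<dots> \<le> real ((Suc k)\<^sup>2) * C / (real ((Suc k)\<^sup>2))\<^sup>2"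
      using h_sum(2) by (rule divide_right_mono) simp
    also have "\<dots> = C * (1 / real ((Suc k)\<^sup>2))"
      by (simp add: power2_eq_square del: of_nat_Suc)
    finally show ?thesis .
  qed
  have "summable (\<lambda>k. expectation (h k))"
  proof (rule summable_comparison_test')
    have "summable (\<lambda>k. 1 / real k ^ 2)"
      using inverse_power_summable[of 2, where 'a = real] by (simp add: inverse_eq_divide)
    then have "summable (\<lambda>k. 1 / real ((Suc k)\<^sup>2))"
      by (subst (asm) summable_Suc_iff[symmetric]) simp
    then show "summable (\<lambda>k. C * (1 / real ((Suc k)\<^sup>2)))"
      by (rule summable_mult)
    show "norm (expectation (h k)) \<le> C * (1 / real ((Suc k)\<^sup>2))" if "k \<ge> 0" for k
      using h_le[of k] by (simp add: h_def integral_nonneg_AE)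
  qed
  then have "AE x in M. (\<lambda>k. h k x) \<longlonglongrightarrow> 0"
    by (rule AE_tendsto_zero_if_summable_expectation[OF h_int, rotated]) (simp add: h_def)
  then show ?thesis
  proof eventually_elim
    case (elim x)
    have "(\<lambda>k. sqrt (h k x)) \<longlonglongrightarrow> sqrt 0"
      by (intro tendsto_intros elim)
    then have "(\<lambda>k. \<bar>(\<Sum>i=1..(Suc k)\<^sup>2. f i x - \<mu>) / real ((Suc k)\<^sup>2)\<bar>) \<longlonglongrightarrow> 0"
      by (simp only: h_def real_sqrt_abs real_sqrt_zero)
    then have "(\<lambda>k. (\<Sum>i=1..(Suc k)\<^sup>2. f i x - \<mu>) / real ((Suc k)\<^sup>2)) \<longlonglongrightarrow> 0"
      by (rule tendsto_rabs_zero_cancel)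
    moreover have "(\<Sum>i=1..n. f i x - \<mu>) / real n = (\<Sum>i=1..n. f i x) / real n - \<mu>"
      if "n \<noteq> 0" for n
      using that by (simp add: sum_subtractf field_simps)
    ultimately have "(\<lambda>k. (\<Sum>i=1..(Suc k)\<^sup>2. f i x) / real ((Suc k)\<^sup>2) - \<mu>) \<longlonglongrightarrow> 0"
      by (simp only: power_eq_0_iff nat.distinct simp_thms not_False_eq_True)
    then have "(\<lambda>k. (\<Sum>i=1..(Suc k)\<^sup>2. f i x) / real ((Suc k)\<^sup>2)) \<longlonglongrightarrow> \<mu>"
      by (rule LIM_zero_cancel)
    then have "(\<lambda>k. (\<Sum>i=1..k\<^sup>2. f i x) / real (k\<^sup>2)) \<longlonglongrightarrow> \<mu>"
      by (rule LIMSEQ_imp_Suc[of "\<lambda>k. (\<Sum>i=1..k\<^sup>2. f i x) / real (k\<^sup>2)"])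
    then show ?case
      by (intro tendsto_average_if_squares)
        (auto intro!: monoI sum_mono2 sum_nonneg nonneg)
  qed
qed

text \<open>Positive and negative parts are again independent and identically distributed, and inherit the
  second moment, so the nonnegative case applies to each.\<close>

lemma strong_law_iid_real:
  fixes g :: "'b \<Rightarrow> real"
  assumes indep: "indep_vars (\<lambda>_. N) \<xi> {1..}"
    and distr: "\<And>i. 1 \<le> i \<Longrightarrow> distr M N (\<xi> i) = distr M N \<eta>"
    and \<eta> [measurable]: "\<eta> \<in> measurable M N"
    and g [measurable]: "g \<in> borel_measurable N"
    and sq: "integrable M (\<lambda>x. (g (\<eta> x))\<^sup>2)"
  shows "AE x in M. (\<lambda>n. (\<Sum>i=1..n. g (\<xi> i x)) / real n) \<longlonglongrightarrow> expectation (\<lambda>x. g (\<eta> x))"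
proof -
  have \<xi> [measurable]: "\<xi> i \<in> measurable M N" if "1 \<le> i" for i
    using indep that by (auto simp: indep_vars_def)
  have transfer: "expectation (\<lambda>x. k (\<xi> i x)) = expectation (\<lambda>x. k (\<eta> x))"
    "integrable M (\<lambda>x. k (\<xi> i x)) \<longleftrightarrow> integrable M (\<lambda>x. k (\<eta> x))"
    if [measurable]: "k \<in> borel_measurable N" and i: "1 \<le> i" for k :: "'b \<Rightarrow> real" and i
    using distr[OF i] \<xi>[OF i]
    by (simp_all flip: integral_distr[of _ M N] integrable_distr_eq[of _ M N])
  have law: "AE x in M. (\<lambda>n. (\<Sum>i=1..n. k (\<xi> i x)) / real n) \<longlonglongrightarrow> expectation (\<lambda>x. k (\<eta> x))"
    if [measurable]: "k \<in> borel_measurable N" and nonneg: "\<And>y. 0 \<le> k y"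
      and k_sq: "integrable M (\<lambda>x. (k (\<eta> x))\<^sup>2)" for k
  proof (rule strong_law_nonneg_uncorrelated)
    fix i j :: nat assume ij: "1 \<le> i" "1 \<le> j" "i \<noteq> j"
    have "indep_vars (\<lambda>_. borel) (\<lambda>l x. k (\<xi> l x)) {i, j}"
      using ij by (intro indep_vars_compose2[OF indep_vars_subset[OF indep]]) auto
    moreover have "integrable M (\<lambda>x. k (\<xi> i x))" if "1 \<le> i" for i
      using integrable_if_square_integrable[of "\<lambda>x. k (\<eta> x)"] k_sq transfer(2)[of k i] that by simp
    ultimately show "expectation (\<lambda>x. k (\<xi> i x) * k (\<xi> j x)) = (expectation (\<lambda>x. k (\<eta> x)))\<^sup>2"
      using indep_vars_lebesgue_integral[of "{i, j}" "\<lambda>l x. k (\<xi> l x)"] ij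
      by (auto simp: transfer(1) power2_eq_square)
  next
    fix i :: nat assume i: "1 \<le> i"
    show "expectation (\<lambda>x. (k (\<xi> i x))\<^sup>2) \<le> expectation (\<lambda>x. (k (\<eta> x))\<^sup>2)"
      using transfer(1)[of "\<lambda>y. (k y)\<^sup>2" i] i by simp
    show "integrable M (\<lambda>x. (k (\<xi> i x))\<^sup>2)"
      using transfer(2)[of "\<lambda>y. (k y)\<^sup>2" i] i k_sq by simp
    show "expectation (\<lambda>x. k (\<xi> i x)) = expectation (\<lambda>x. k (\<eta> x))"
      using transfer(1) i by simp
    show "(\<lambda>x. k (\<xi> i x)) \<in> borel_measurable M"
      using i by measurable
  qed (simp add: nonneg)
  have pos_sq: "integrable M (\<lambda>x. (max 0 (s * g (\<eta> x)))\<^sup>2)" if "\<bar>s\<bar> = 1" for s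
  proof (rule Bochner_Integration.integrable_bound[OF sq])
    have "(max 0 (s * a))\<^sup>2 \<le> a\<^sup>2" for a
      using that abs_mult[of s a] by (auto simp flip: abs_le_square_iff)
    then show "AE x in M. norm ((max 0 (s * g (\<eta> x)))\<^sup>2) \<le> norm ((g (\<eta> x))\<^sup>2)"
      by simp
  qed measurable
  have pos_int: "integrable M (\<lambda>x. max 0 (s * g (\<eta> x)))" if "\<bar>s\<bar> = 1" for s
    by (rule integrable_if_square_integrable[OF _ pos_sq[OF that]]) measurable
  \<comment> \<open>the factors 1 and -1 let the facts above be used for both parts\<close>
  have split: "a = max 0 (1 * a) - max 0 (-1 * a)" for a :: real
    by (simp add: max_def)
  have "AE x in M. (\<lambda>n. (\<Sum>i=1..n. max 0 (1 * g (\<xi> i x))) / real n)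
      \<longlonglongrightarrow> expectation (\<lambda>x. max 0 (1 * g (\<eta> x)))"
    by (rule law[of "\<lambda>y. max 0 (1 * g y)"]) (use pos_sq[of 1] in simp_all)
  moreover have "AE x in M. (\<lambda>n. (\<Sum>i=1..n. max 0 (-1 * g (\<xi> i x))) / real n)
      \<longlonglongrightarrow> expectation (\<lambda>x. max 0 (-1 * g (\<eta> x)))"
    by (rule law[of "\<lambda>y. max 0 (-1 * g y)"]) (use pos_sq[of "-1"] in simp_all)
  ultimately show ?thesis
  proof eventually_elim
    case (elim x)
    have "expectation (\<lambda>x. g (\<eta> x))
        = expectation (\<lambda>x. max 0 (1 * g (\<eta> x))) - expectation (\<lambda>x. max 0 (-1 * g (\<eta> x)))"
      by (subst Bochner_Integration.integral_diff[symmetric])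
        (simp_all only: pos_int abs_one abs_minus_cancel split[symmetric])
    moreover have "(\<Sum>i=1..n. g (\<xi> i x)) / real n
        = (\<Sum>i=1..n. max 0 (1 * g (\<xi> i x))) / real n - (\<Sum>i=1..n. max 0 (-1 * g (\<xi> i x))) / real n"
      for n
      unfolding diff_divide_distrib[symmetric] sum_subtractf[symmetric] by (simp only: split[symmetric])
    ultimately show ?case
      using tendsto_diff[OF elim] by (simp only:)
  qed
qed

lemma strong_law_iid_euclidean:
  fixes g :: "'b \<Rightarrow> 'c::euclidean_space"
  assumes indep: "indep_vars (\<lambda>_. N) \<xi> {1..}"
    and distr: "\<And>i. 1 \<le> i \<Longrightarrow> distr M N (\<xi> i) = distr M N \<eta>"
    and \<eta> [measurable]: "\<eta> \<in> measurable M N"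
    and g [measurable]: "g \<in> borel_measurable N"
    and sq: "integrable M (\<lambda>x. (norm (g (\<eta> x)))\<^sup>2)"
  shows "AE x in M. (\<lambda>n. (1 / real n) *\<^sub>R (\<Sum>i=1..n. g (\<xi> i x))) \<longlonglongrightarrow> expectation (\<lambda>x. g (\<eta> x))"
proof -
  have int: "integrable M (\<lambda>x. g (\<eta> x))"
    by (subst integrable_norm_iff[symmetric]) (auto intro: integrable_if_square_integrable sq)
  have "AE x in M. \<forall>b\<in>Basis. (\<lambda>n. (\<Sum>i=1..n. g (\<xi> i x) \<bullet> b) / real n)
      \<longlonglongrightarrow> expectation (\<lambda>x. g (\<eta> x) \<bullet> b)"
  proof (rule AE_finite_allI)
    fix b :: 'c assume b: "b \<in> Basis"
    have "integrable M (\<lambda>x. (g (\<eta> x) \<bullet> b)\<^sup>2)"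
      by (rule Bochner_Integration.integrable_bound[OF sq])
        (use b in \<open>auto simp: abs_le_square_iff[symmetric] Basis_le_norm\<close>)
    then show "AE x in M. (\<lambda>n. (\<Sum>i=1..n. g (\<xi> i x) \<bullet> b) / real n)
        \<longlonglongrightarrow> expectation (\<lambda>x. g (\<eta> x) \<bullet> b)"
      using strong_law_iid_real[OF indep distr \<eta>, of "\<lambda>y. g y \<bullet> b"] by simp
  qed simp
  then show ?thesis
  proof eventually_elim
    case (elim x)
    show ?case
    proof (rule tendsto_componentwise_iff[THEN iffD2], intro ballI)
      fix b :: 'c assume "b \<in> Basis"
      then show "(\<lambda>n. ((1 / real n) *\<^sub>R (\<Sum>i=1..n. g (\<xi> i x))) \<bullet> b)
          \<longlonglongrightarrow> expectation (\<lambda>x. g (\<eta> x)) \<bullet> b"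
        using elim int by (simp add: inner_sum_left)
    qed
  qed
qed

end

section \<open>Matrices: continuity, measurability and inverses\<close>

lemma bounded_bilinear_matrix_mult:
  "bounded_bilinear ((**) :: real ^ 'n::finite ^ 'm::finite \<Rightarrow> real ^ 'k::finite ^ 'n \<Rightarrow> real ^ 'k ^ 'm)"
  unfolding bilinear_conv_bounded_bilinear[symmetric] bilinear_def
  by (auto intro!: linearI
      simp: matrix_matrix_mult_def vec_eq_iff algebra_simps sum.distrib sum_distrib_left)

lemma bounded_bilinear_matrix_vector_mult:
  "bounded_bilinear ((*v) :: real ^ 'n::finite ^ 'm::finite \<Rightarrow> real ^ 'n \<Rightarrow> real ^ 'm)"
  unfolding bilinear_conv_bounded_bilinear[symmetric] bilinear_def
  by (auto intro!: linearI
      simp: matrix_vector_mult_def vec_eq_iff algebra_simps sum.distrib sum_distrib_left)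

lemma tensor_nth: "tensor u v $ i $ j = v $ i * u $ j"
  by (simp add: tensor_def matrix_def inner_axis)

lemma bounded_bilinear_tensor:
  "bounded_bilinear (tensor :: real ^ 'p::finite \<Rightarrow> real ^ 'p \<Rightarrow> real ^ 'p ^ 'p)"
  unfolding bilinear_conv_bounded_bilinear[symmetric] bilinear_def
  by (auto intro!: linearI simp: tensor_nth vec_eq_iff algebra_simps)

lemmas tendsto_matrix_mult = bounded_bilinear.tendsto[OF bounded_bilinear_matrix_mult]
lemmas tendsto_matrix_vector_mult = bounded_bilinear.tendsto[OF bounded_bilinear_matrix_vector_mult]
lemmas tendsto_tensor = bounded_bilinear.tendsto[OF bounded_bilinear_tensor]

lemma borel_measurable_bounded_bilinear:
  fixes f :: "'a \<Rightarrow> 'b::{real_normed_vector, second_countable_topology}"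
    and g :: "'a \<Rightarrow> 'c::{real_normed_vector, second_countable_topology}"
  assumes h: "bounded_bilinear h" and f: "f \<in> borel_measurable M" and g: "g \<in> borel_measurable M"
  shows "(\<lambda>x. h (f x) (g x)) \<in> borel_measurable M"
  by (rule borel_measurable_continuous_Pair[OF f g, of h], rule bounded_bilinear.continuous_on[OF h
      continuous_on_fst[OF continuous_on_id] continuous_on_snd[OF continuous_on_id]])

lemmas borel_measurable_matrix_mult =
  borel_measurable_bounded_bilinear[OF bounded_bilinear_matrix_mult]
lemmas borel_measurable_matrix_vector_mult =
  borel_measurable_bounded_bilinear[OF bounded_bilinear_matrix_vector_mult]
lemmas borel_measurable_tensor = borel_measurable_bounded_bilinear[OF bounded_bilinear_tensor]

lemma borel_measurable_vec_nth:
  fixes f :: "'a \<Rightarrow> 'b::real_normed_vector ^ 'n::finite"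
  assumes "f \<in> borel_measurable M"
  shows "(\<lambda>x. f x $ i) \<in> borel_measurable M"
proof -
  have "(\<lambda>v :: 'b ^ 'n. v $ i) \<in> borel_measurable borel"
    by (intro borel_measurable_continuous_onI continuous_intros)
  then show ?thesis
    by (rule measurable_compose[OF assms])
qed

text \<open>The Borel sets of a space of vectors over a Euclidean space are generated by the coordinates.\<close>

lemma borel_measurable_vecI:
  fixes f :: "'a \<Rightarrow> 'b::euclidean_space ^ 'n::finite"
  assumes "\<And>i. (\<lambda>x. f x $ i) \<in> borel_measurable M"
  shows "f \<in> borel_measurable M"
  unfolding borel_measurable_euclidean_space[of f]
proof
  fix b :: "'b ^ 'n" assume "b \<in> Basis"
  then obtain i u where "b = axis i u"
    by (auto simp: Basis_vec_def)
  then show "(\<lambda>x. f x \<bullet> b) \<in> borel_measurable M"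
    using assms[of i] by (simp add: inner_axis)
qed

lemma borel_measurable_matrix_nth:
  fixes f :: "'a \<Rightarrow> real ^ 'n::finite ^ 'm::finite"
  shows "f \<in> borel_measurable M \<Longrightarrow> (\<lambda>x. f x $ i $ j) \<in> borel_measurable M"
  by (rule borel_measurable_vec_nth[OF borel_measurable_vec_nth])

lemma borel_measurable_det:
  fixes f :: "'a \<Rightarrow> real ^ 'n::finite ^ 'n"
  assumes "f \<in> borel_measurable M"
  shows "(\<lambda>x. det (f x)) \<in> borel_measurable M"
  unfolding det_def
  by (intro borel_measurable_sum borel_measurable_times borel_measurable_prod
      borel_measurable_const borel_measurable_matrix_nth assms)

lemma tendsto_det:
  fixes f :: "'a \<Rightarrow> real ^ 'n::finite ^ 'n"
  assumes "(f \<longlongrightarrow> A) F"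
  shows "((\<lambda>x. det (f x)) \<longlongrightarrow> det A) F"
  unfolding det_def by (intro tendsto_intros assms)

lemma matrix_inv:
  assumes "invertible A"
  shows matrix_inv_right: "A ** matrix_inv A = mat 1"
    and matrix_inv_left: "matrix_inv A ** A = mat 1"
  using someI_ex[OF assms[unfolded invertible_def]] by (auto simp: matrix_inv_def)

text \<open>Cramer's rule, applied to the columns of the inverse. It exhibits the entries of the inverse as
  quotients of polynomials in the entries, hence both continuity and measurability.\<close>

lemma matrix_inv_nth_cramer:
  fixes A :: "real ^ 'n::finite ^ 'n"
  assumes "det A \<noteq> 0"
  shows "matrix_inv A $ i $ j
    = det (\<chi> r s. if s = i then axis j 1 $ r else A $ r $ s) / det A"
proof -
  have "A *v (matrix_inv A *v axis j 1) = axis j 1"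
    using assms by (simp add: matrix_vector_mul_assoc matrix_inv_right invertible_det_nz)
  then have "matrix_inv A *v axis j 1
      = (\<chi> k. det (\<chi> r s. if s = k then axis j 1 $ r else A $ r $ s) / det A)"
    by (simp only: cramer[OF assms])
  then have "(matrix_inv A *v axis j 1) $ i
      = det (\<chi> r s. if s = i then axis j 1 $ r else A $ r $ s) / det A"
    by (simp only: vec_lambda_beta)
  then show ?thesis
    by (simp add: matrix_vector_mult_basis column_def)
qed

lemma tendsto_matrix_inv:
  fixes f :: "'a \<Rightarrow> real ^ 'n::finite ^ 'n"
  assumes f: "(f \<longlongrightarrow> A) F" and A: "det A \<noteq> 0"
  shows "((\<lambda>x. matrix_inv (f x)) \<longlongrightarrow> matrix_inv A) F"
proof (intro vec_tendstoI)
  fix i j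
  have rep: "((\<lambda>x. \<chi> r s. if s = i then axis j 1 $ r else f x $ r $ s)
      \<longlongrightarrow> (\<chi> r s. if s = i then axis j 1 $ r else A $ r $ s)) F"
    by (intro tendsto_vec_lambda) (auto intro!: tendsto_intros f)
  have lim: "((\<lambda>x. det (\<chi> r s. if s = i then axis j 1 $ r else f x $ r $ s) / det (f x))
      \<longlongrightarrow> matrix_inv A $ i $ j) F"
    unfolding matrix_inv_nth_cramer[OF A] by (intro tendsto_divide tendsto_det rep f A)
  have "\<forall>\<^sub>F x in F. det (f x) \<noteq> 0"
    using tendsto_imp_eventually_ne[OF tendsto_det[OF f] A] .
  then have "\<forall>\<^sub>F x in F. det (\<chi> r s. if s = i then axis j 1 $ r else f x $ r $ s) / det (f x)
      = matrix_inv (f x) $ i $ j"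
    by eventually_elim (simp add: matrix_inv_nth_cramer)
  then show "((\<lambda>x. matrix_inv (f x) $ i $ j) \<longlongrightarrow> matrix_inv A $ i $ j) F"
    by (rule Lim_transform_eventually[OF lim])
qed

text \<open>On singular matrices \<open>matrix_inv\<close> is a fixed choice that does not depend on the matrix, so it is
  measurable on all matrices.\<close>

lemma borel_measurable_matrix_inv:
  fixes f :: "'a \<Rightarrow> real ^ 'n::finite ^ 'n"
  assumes f: "f \<in> borel_measurable M"
  shows "(\<lambda>x. matrix_inv (f x)) \<in> borel_measurable M"
proof (intro borel_measurable_vecI)
  fix i j
  \<comment> \<open>the value of \<open>matrix_inv\<close> on every singular matrix\<close>
  define C :: "real ^ 'n ^ 'n" where "C = (SOME B. False)"
  have singular: "matrix_inv A = C" if "det A = 0" for A :: "real ^ 'n ^ 'n"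
  proof -
    have "(\<lambda>B. A ** B = mat 1 \<and> B ** A = mat 1) = (\<lambda>B. False)"
      using that invertible_det_nz[of A] by (auto simp: invertible_def)
    then show ?thesis
      by (simp add: matrix_inv_def C_def)
  qed
  have "(\<lambda>x. matrix_inv (f x) $ i $ j) = (\<lambda>x. if det (f x) = 0 then C $ i $ j
      else det (\<chi> r s. if s = i then axis j 1 $ r else f x $ r $ s) / det (f x))"
    by (auto simp: fun_eq_iff singular matrix_inv_nth_cramer)
  also have "\<dots> \<in> borel_measurable M"
  proof -
    have [measurable]: "(\<lambda>x. det (f x)) \<in> borel_measurable M"
      by (rule borel_measurable_det[OF f])
    have [measurable]:
      "(\<lambda>x. det (\<chi> r s. if s = i then axis j 1 $ r else f x $ r $ s)) \<in> borel_measurable M"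
    proof (intro borel_measurable_det borel_measurable_vecI)
      fix r s
      show "(\<lambda>x. (\<chi> r s. if s = i then axis j 1 $ r else f x $ r $ s) $ r $ s) \<in> borel_measurable M"
        using borel_measurable_matrix_nth[OF f] by (cases "s = i") simp_all
    qed
    show ?thesis by measurable
  qed
  finally show "(\<lambda>x. matrix_inv (f x) $ i $ j) \<in> borel_measurable M" .
qed

section \<open>Compressions to coordinate subspaces\<close>

definition coord_proj :: "'p set \<Rightarrow> real ^ 'p ^ 'p" where
  "coord_proj K = (\<chi> i j. of_bool (i = j \<and> i \<in> K))"

text \<open>The operator that agrees with the compression of \<open>V\<close> on the coordinates in \<open>K\<close> and with the
  identity on the others. It replaces the compression, which acts on a space that depends on \<open>K\<close>,
  by a square matrix of fixed size with the same invertibility.\<close>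

definition padded :: "'p set \<Rightarrow> real ^ 'p ^ 'p \<Rightarrow> real ^ 'p ^ 'p" where
  "padded K V = coord_proj K ** V ** coord_proj K + (mat 1 - coord_proj K)"

definition Q_padded :: "'p set \<Rightarrow> real ^ 'p ^ 'p \<Rightarrow> real ^ 'p ^ 'p" where
  "Q_padded K V = matrix_inv (padded K V) ** coord_proj K"

lemma coord_proj_apply_nth: "(coord_proj K *v x) $ i = (if i \<in> K then x $ i else 0)"
  for K :: "'p::finite set"
proof -
  have "(\<Sum>j\<in>UNIV. of_bool (i = j \<and> i \<in> K) * x $ j)
      = (\<Sum>j\<in>UNIV. if j = i then (if i \<in> K then x $ i else 0) else 0)"
    by (intro sum.cong) auto
  then show ?thesis
    by (simp add: coord_proj_def matrix_vector_mult_def)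
qed

lemma coord_proj_apply: "coord_proj K *v x = coord_adj K (coord K x)"
  for K :: "'p::finite set"
  by (simp add: vec_eq_iff coord_proj_apply_nth coord_adj_def coord_def)

lemma coord_proj_idem: "coord_proj K ** coord_proj K = coord_proj K" for K :: "'p::finite set"
  by (simp add: matrix_eq vec_eq_iff coord_proj_apply_nth flip: matrix_vector_mul_assoc)

lemma coord_coord_adj: "y \<in> coord_space K \<Longrightarrow> coord K (coord_adj K y) = y" for K :: "'p::finite set"
  by (rule ext) (auto simp: coord_def coord_adj_def coord_space_def PiE_def extensional_def)

lemma coord_in_coord_space: "coord K x \<in> coord_space K"
  by (simp add: coord_def coord_space_def)

lemma coord_proj_mult_padded: "coord_proj K ** padded K V = coord_proj K ** V ** coord_proj K"
  for K :: "'p::finite set"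
  by (simp add: padded_def matrix_add_ldistrib matrix_mul_assoc coord_proj_idem
      bounded_bilinear.diff_right[OF bounded_bilinear_matrix_mult])

lemma padded_mult_coord_proj: "padded K V ** coord_proj K = coord_proj K ** V ** coord_proj K"
  for K :: "'p::finite set"
  by (simp add: padded_def bounded_bilinear.add_left[OF bounded_bilinear_matrix_mult]
      bounded_bilinear.diff_left[OF bounded_bilinear_matrix_mult] coord_proj_idem
      flip: matrix_mul_assoc)

lemma padded_apply_nth:
  "(padded K V *v x) $ i = (if i \<in> K then (V *v (coord_proj K *v x)) $ i else x $ i)"
  for K :: "'p::finite set"
  by (simp add: padded_def matrix_vector_mult_add_rdistrib matrix_vector_mult_diff_rdistrib
      coord_proj_apply_nth flip: matrix_vector_mul_assoc)

lemma padded_apply_coord_adj: "padded K V *v coord_adj K y = coord_adj K (compress K V y)"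
  for K :: "'p::finite set"
proof -
  have "coord_proj K *v coord_adj K y = coord_adj K y"
    by (simp add: vec_eq_iff coord_proj_apply_nth coord_adj_def)
  then show ?thesis
    by (subst vec_eq_iff) (simp add: padded_apply_nth, simp add: coord_adj_def compress_def coord_def)
qed

lemma fixed_by_coord_proj_if_padded_apply:
  "padded K V *v x = coord_adj K y \<Longrightarrow> coord_adj K (coord K x) = x"
  for K :: "'p::finite set"
  unfolding vec_eq_iff padded_apply_nth
  by (auto simp: coord_adj_def coord_def split: if_splits)

lemma coord_adj_inject:
  "y \<in> coord_space K \<Longrightarrow> z \<in> coord_space K \<Longrightarrow> coord_adj K y = coord_adj K z \<longleftrightarrow> y = z"
  for K :: "'p::finite set"
  by (metis coord_coord_adj)

lemma compress_in_coord_space: "compress K V y \<in> coord_space K"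
  by (simp add: compress_def coord_in_coord_space)

text \<open>Solutions of \<open>padded K V x = y\<close> with \<open>y\<close> supported in \<open>K\<close> are supported in \<open>K\<close>; on such vectors
  \<open>padded K V\<close> is the compression, and on the complement it is the identity.\<close>

lemma compress_invertible_iff: "compress_invertible K V \<longleftrightarrow> invertible (padded K V)"
  for K :: "'p::finite set"
proof
  assume inv: "compress_invertible K V"
  have "x = 0" if x: "padded K V *v x = 0" for x
  proof -
    have x_eq: "coord_adj K (coord K x) = x"
      using x by (intro fixed_by_coord_proj_if_padded_apply[of K V x "\<lambda>_. 0"])
        (simp add: coord_adj_def vec_eq_iff)
    have zero_eq: "coord_adj K (coord K 0) = 0"
      by (simp add: coord_adj_def coord_def vec_eq_iff)
    have "coord_adj K (compress K V (coord K x)) = coord_adj K (compress K V (coord K 0))"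
      unfolding padded_apply_coord_adj[symmetric] x_eq zero_eq using x by simp
    then have "compress K V (coord K x) = compress K V (coord K 0)"
      by (simp add: coord_adj_inject compress_in_coord_space)
    then have "coord K x = coord K 0"
      using inv by (auto simp: compress_invertible_def bij_betw_def inj_on_def coord_in_coord_space)
    then show "x = 0"
      using x_eq zero_eq by simp
  qed
  then show "invertible (padded K V)"
    by (simp add: invertible_left_inverse matrix_left_invertible_ker)
next
  assume inv: "invertible (padded K V)"
  show "compress_invertible K V"
    unfolding compress_invertible_def
  proof (rule bij_betwI')
    fix y z assume yz: "y \<in> coord_space K" "z \<in> coord_space K"
    have "compress K V y = compress K V z
        \<longleftrightarrow> padded K V *v coord_adj K y = padded K V *v coord_adj K z"
      by (simp add: padded_apply_coord_adj coord_adj_inject compress_in_coord_space)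
    also have "\<dots> \<longleftrightarrow> coord_adj K y = coord_adj K z"
      by (rule inj_eq[OF inj_matrix_vector_mult[OF inv]])
    also have "\<dots> \<longleftrightarrow> y = z"
      using yz by (rule coord_adj_inject)
    finally show "compress K V y = compress K V z \<longleftrightarrow> y = z" .
  next
    fix z assume z: "z \<in> coord_space K"
    define x where "x = matrix_inv (padded K V) *v coord_adj K z"
    have x: "padded K V *v x = coord_adj K z"
      using inv by (simp add: x_def matrix_vector_mul_assoc matrix_inv_right)
    then have "coord_adj K (compress K V (coord K x)) = coord_adj K z"
      by (simp add: fixed_by_coord_proj_if_padded_apply[OF x] flip: padded_apply_coord_adj)
    then have "z = compress K V (coord K x)"
      using z by (simp add: coord_adj_inject compress_in_coord_space)
    then show "\<exists>y\<in>coord_space K. z = compress K V y"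
      using coord_in_coord_space by blast
  qed (simp add: compress_in_coord_space)
qed

lemma Q_op_eq_Q_padded:
  fixes K :: "'p::finite set"
  assumes "compress_invertible K V"
  shows "Q_op K V = Q_padded K V"
proof -
  have inv: "invertible (padded K V)"
    using assms by (simp add: compress_invertible_iff)
  have "coord_adj K (inv_into (coord_space K) (compress K V) (coord K x)) = Q_padded K V *v x" for x
  proof -
    let ?y = "inv_into (coord_space K) (compress K V) (coord K x)"
    have "compress K V ?y = coord K x"
      by (rule f_inv_into_f[of _ "compress K V" "coord_space K"])
        (use assms coord_in_coord_space in \<open>auto simp: compress_invertible_def bij_betw_def\<close>)
    then have "padded K V *v coord_adj K ?y = coord_proj K *v x"
      by (simp add: padded_apply_coord_adj coord_proj_apply)
    then have "matrix_inv (padded K V) *v (padded K V *v coord_adj K ?y) = Q_padded K V *v x"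
      by (simp add: Q_padded_def matrix_vector_mul_assoc)
    then show ?thesis
      using inv by (simp add: matrix_vector_mul_assoc matrix_inv_left)
  qed
  then show ?thesis
    by (simp add: Q_op_def matrix_of_matrix_vector_mul)
qed

lemma Q_padded_mult_coord_proj: "Q_padded K V ** coord_proj K = Q_padded K V"
  for K :: "'p::finite set"
  by (simp add: Q_padded_def coord_proj_idem flip: matrix_mul_assoc)

context
  fixes K :: "'p::finite set" and V :: "real ^ 'p ^ 'p"
  assumes inv: "invertible (padded K V)"
begin

text \<open>A matrix that commutes with an invertible one commutes with its inverse.\<close>

lemma coord_proj_matrix_inv_padded:
  "coord_proj K ** matrix_inv (padded K V) = matrix_inv (padded K V) ** coord_proj K"
proof -
  have "matrix_inv (padded K V) ** (padded K V ** coord_proj K) ** matrix_inv (padded K V)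
      = matrix_inv (padded K V) ** (coord_proj K ** padded K V) ** matrix_inv (padded K V)"
    by (simp only: padded_mult_coord_proj coord_proj_mult_padded)
  also have "\<dots> = matrix_inv (padded K V) ** coord_proj K ** (padded K V ** matrix_inv (padded K V))"
    by (simp only: matrix_mul_assoc)
  finally show ?thesis
    by (simp add: matrix_mul_assoc matrix_inv_left[OF inv] matrix_inv_right[OF inv])
qed

lemma coord_proj_mult_Q_padded: "coord_proj K ** Q_padded K V = Q_padded K V"
proof -
  have "coord_proj K ** Q_padded K V = matrix_inv (padded K V) ** (coord_proj K ** coord_proj K)"
    by (simp add: Q_padded_def matrix_mul_assoc coord_proj_matrix_inv_padded)
  then show ?thesis
    by (simp add: coord_proj_idem Q_padded_def)
qed

lemma coord_proj_mult_V_mult_Q_padded: "coord_proj K ** V ** Q_padded K V = coord_proj K"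
proof -
  have "coord_proj K ** V ** Q_padded K V = coord_proj K ** V ** (coord_proj K ** Q_padded K V)"
    by (simp only: coord_proj_mult_Q_padded)
  also have "\<dots> = coord_proj K ** padded K V ** Q_padded K V"
    by (simp only: matrix_mul_assoc coord_proj_mult_padded)
  also have "\<dots> = coord_proj K ** (padded K V ** matrix_inv (padded K V)) ** coord_proj K"
    by (simp only: Q_padded_def matrix_mul_assoc)
  finally show ?thesis
    by (simp add: matrix_inv_right[OF inv] coord_proj_idem)
qed

lemma Q_padded_mult_V_mult_coord_proj: "Q_padded K V ** V ** coord_proj K = coord_proj K"
proof -
  have "Q_padded K V ** V ** coord_proj K
      = matrix_inv (padded K V) ** (coord_proj K ** V ** coord_proj K)"
    by (simp only: Q_padded_def matrix_mul_assoc)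
  also have "\<dots> = matrix_inv (padded K V) ** padded K V ** coord_proj K"
    by (simp only: padded_mult_coord_proj flip: matrix_mul_assoc)
  finally show ?thesis
    by (simp add: matrix_inv_left[OF inv])
qed

end

text \<open>With \<open>P\<close> the coordinate projection, \<open>P V Q = P\<close> and \<open>Q V P = P\<close>, for \<open>V\<close> and for \<open>W\<close>
  alike. Writing \<open>Q'\<close> for the operator of \<open>W\<close>, these give \<open>Q' W Q = Q\<close> and \<open>Q' V Q = Q'\<close>, and
  expanding the right-hand side leaves only the left-hand side.\<close>

lemma oblique_projection_difference:
  fixes K :: "'p::finite set"
  assumes V: "invertible (padded K V)" and W: "invertible (padded K W)"
  shows "W ** Q_padded K W - V ** Q_padded K V
    = (mat 1 - W ** Q_padded K W) ** (W - V) ** Q_padded K V"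
proof -
  have "Q_padded K W ** W ** Q_padded K V = Q_padded K W ** W ** (coord_proj K ** Q_padded K V)"
    by (simp only: coord_proj_mult_Q_padded[OF V])
  also have "\<dots> = Q_padded K W ** W ** coord_proj K ** Q_padded K V"
    by (simp only: matrix_mul_assoc)
  also have "\<dots> = Q_padded K V"
    by (simp only: Q_padded_mult_V_mult_coord_proj[OF W] coord_proj_mult_Q_padded[OF V])
  finally have 1: "Q_padded K W ** W ** Q_padded K V = Q_padded K V" .
  have "Q_padded K W ** V ** Q_padded K V = Q_padded K W ** (coord_proj K ** V ** Q_padded K V)"
    by (simp only: matrix_mul_assoc Q_padded_mult_coord_proj)
  then have 2: "Q_padded K W ** V ** Q_padded K V = Q_padded K W"
    by (simp only: coord_proj_mult_V_mult_Q_padded[OF V] Q_padded_mult_coord_proj)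
  show ?thesis
    using 1 2 by (simp add: bounded_bilinear.diff_left[OF bounded_bilinear_matrix_mult]
        bounded_bilinear.diff_right[OF bounded_bilinear_matrix_mult] flip: matrix_mul_assoc)
qed

text \<open>A vector of the kernel is supported in \<open>K\<close>, where its image under \<open>V\<close> vanishes; so it is
  orthogonal to that image.\<close>

lemma invertible_padded_if_positive_definite:
  fixes K :: "'p::finite set"
  assumes pos: "\<And>x. x \<noteq> 0 \<Longrightarrow> x \<bullet> (V *v x) > 0"
  shows "invertible (padded K V)"
proof -
  have "x = 0" if x: "padded K V *v x = 0" for x
  proof (rule ccontr)
    assume "x \<noteq> 0"
    have row: "(if i \<in> K then (V *v (coord_proj K *v x)) $ i else x $ i) = 0" for i
      using x by (metis padded_apply_nth zero_index)
    have "coord_proj K *v x = x"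
      unfolding vec_eq_iff coord_proj_apply_nth using row by (metis (full_types))
    then have "x $ i * (V *v x) $ i = 0" for i
      using row[of i] by (simp split: if_splits)
    then have "x \<bullet> (V *v x) = 0"
      unfolding inner_vec_def by (intro sum.neutral) simp
    then show False
      using pos[OF \<open>x \<noteq> 0\<close>] by simp
  qed
  then show ?thesis
    by (simp add: invertible_left_inverse matrix_left_invertible_ker)
qed

lemma tendsto_padded: "(f \<longlongrightarrow> V) F \<Longrightarrow> ((\<lambda>x. padded K (f x)) \<longlongrightarrow> padded K V) F"
  for K :: "'p::finite set"
  unfolding padded_def by (intro tendsto_add tendsto_matrix_mult tendsto_const)

lemma tendsto_Q_padded:
  fixes K :: "'p::finite set"
  assumes "(f \<longlongrightarrow> V) F" and "invertible (padded K V)"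
  shows "((\<lambda>x. Q_padded K (f x)) \<longlongrightarrow> Q_padded K V) F"
  unfolding Q_padded_def using assms
  by (intro tendsto_matrix_mult tendsto_matrix_inv tendsto_padded tendsto_const)
    (simp_all add: invertible_det_nz)

lemma eventually_invertible_padded:
  fixes K :: "'p::finite set"
  assumes "(f \<longlongrightarrow> V) F" and "invertible (padded K V)"
  shows "\<forall>\<^sub>F x in F. invertible (padded K (f x))"
  unfolding invertible_det_nz
  using assms by (intro tendsto_imp_eventually_ne[OF tendsto_det[OF tendsto_padded]])
    (simp_all add: invertible_det_nz)

lemma borel_measurable_Q_padded:
  fixes K :: "'p::finite set"
  assumes "f \<in> borel_measurable M"
  shows "(\<lambda>x. Q_padded K (f x)) \<in> borel_measurable M"
  unfolding Q_padded_def padded_def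
  by (intro borel_measurable_matrix_mult borel_measurable_matrix_inv borel_measurable_add
      borel_measurable_const assms)

section \<open>Convergence in operator norm\<close>

text \<open>The operator norm is at most the sum of the norms of the values on the finite basis.\<close>

lemma onorm_tendsto_zero_if_pointwise:
  fixes g :: "nat \<Rightarrow> 'b::euclidean_space \<Rightarrow> 'c::real_normed_vector"
  assumes lin: "\<And>n. linear (g n)" and lim: "\<And>x. (\<lambda>n. g n x) \<longlonglongrightarrow> 0"
  shows "(\<lambda>n. onorm (g n)) \<longlonglongrightarrow> 0"
proof (rule tendsto_sandwich[OF _ _ tendsto_const])
  show "\<forall>\<^sub>F n in sequentially. 0 \<le> onorm (g n)"
    using onorm_pos_le[OF linear_conv_bounded_linear[THEN iffD1, OF lin]] by simp
  have "onorm (g n) \<le> (\<Sum>b\<in>Basis. norm (g n b))" for n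
  proof (rule onorm_le)
    fix x
    have "norm (g n x) = norm (\<Sum>b\<in>Basis. (x \<bullet> b) *\<^sub>R g n b)"
      using lin[of n] by (metis (no_types, lifting) euclidean_representation linear_sum linear_scale sum.cong)
    also have "\<dots> \<le> (\<Sum>b\<in>Basis. norm x * norm (g n b))"
      by (rule sum_norm_le) (simp add: mult_right_mono Basis_le_norm)
    finally show "norm (g n x) \<le> (\<Sum>b\<in>Basis. norm (g n b)) * norm x"
      by (simp add: sum_distrib_left mult.commute)
  qed
  then show "\<forall>\<^sub>F n in sequentially. onorm (g n) \<le> (\<Sum>b\<in>Basis. norm (g n b))"
    by simp
  show "(\<lambda>n. \<Sum>b\<in>Basis. norm (g n b)) \<longlonglongrightarrow> 0"
    by (intro tendsto_null_sum tendsto_norm_zero lim)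
qed

section \<open>The parameters and operators as functions on \<open>\<E>\<close>\<close>

lemma linear_pi1: "linear (pi1 l m)" and linear_pi2: "linear (pi2 m)" and linear_pi3: "linear (pi3 m)"
  and linear_pi4: "linear (pi4 l m)" and linear_pi5: "linear (pi5 m)"
  by (auto intro!: linearI simp: pi1_def pi2_def pi3_def pi4_def pi5_def split: prod.splits)

lemmas linear_pis = linear_pi1 linear_pi2 linear_pi3 linear_pi4 linear_pi5

lemmas pi_simps =
  linear_pis[THEN linear_add] linear_pis[THEN linear_diff] linear_pis[THEN linear_scale]

lemmas tendsto_pi =
  linear_pis[THEN linear_conv_bounded_linear[THEN iffD1], THEN bounded_linear.tendsto]

lemma borel_measurable_linear:
  fixes h :: "'b::euclidean_space \<Rightarrow> 'c::euclidean_space"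
  assumes "linear h" and f: "f \<in> borel_measurable M"
  shows "(\<lambda>x. h (f x)) \<in> borel_measurable M"
  using borel_measurable_continuous_onI[OF linear_continuous_on[OF
        linear_conv_bounded_linear[THEN iffD1, OF assms(1)]]]
  by (rule measurable_compose[OF f])

lemmas borel_measurable_pi = linear_pis[THEN borel_measurable_linear]

text \<open>The parameters as functions of a point \<open>w\<close> of \<open>\<E>\<close>. At \<open>w = E W\<close> they are the population
  parameters, at the sample mean the estimators. The covariance uses
  \<open>E ((X - \<mu>) \<otimes> (X - \<mu>)) = E (X \<otimes> X) - \<mu> \<otimes> \<mu>\<close>, conditionally on \<open>U = m\<close>.\<close>

definition mean_at :: "'m \<Rightarrow> ('p::finite, 'l::finite, 'm::finite) E_space \<Rightarrow> real ^ 'p" where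
  "mean_at m w = (1 / pi3 m w) *\<^sub>R pi2 m w"

definition cmean_at :: "'l \<Rightarrow> 'm \<Rightarrow> ('p::finite, 'l::finite, 'm::finite) E_space \<Rightarrow> real ^ 'p" where
  "cmean_at l m w = (1 / pi4 l m w) *\<^sub>R pi1 l m w"

definition cprob_at :: "'l \<Rightarrow> 'm \<Rightarrow> ('p::finite, 'l::finite, 'm::finite) E_space \<Rightarrow> real" where
  "cprob_at l m w = pi4 l m w / pi3 m w"

definition cov_at :: "'m \<Rightarrow> ('p::finite, 'l::finite, 'm::finite) E_space \<Rightarrow> real ^ 'p ^ 'p" where
  "cov_at m w = (1 / pi3 m w) *\<^sub>R pi5 m w - tensor (mean_at m w) (mean_at m w)"

definition resid_at :: "'p set \<Rightarrow> 'm \<Rightarrow> ('p::finite, 'l::finite, 'm::finite) E_space \<Rightarrow> real ^ 'p ^ 'p"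
  where "resid_at K m w = mat 1 - cov_at m w ** Q_padded K (cov_at m w)"

definition Delta_at :: "'p set \<Rightarrow> 'l \<Rightarrow> 'm \<Rightarrow> ('p::finite, 'l::finite, 'm::finite) E_space \<Rightarrow> real ^ 'p"
  where "Delta_at K l m w = resid_at K m w *v (cmean_at l m w - mean_at m w)"

definition xi_at :: "'p set \<Rightarrow> 'm \<Rightarrow> ('p::finite, 'l::finite, 'm::finite) E_space \<Rightarrow> real" where
  "xi_at K m w = (\<Sum>l\<in>UNIV. (cprob_at l m w)\<^sup>2 * (norm (Delta_at K l m w))\<^sup>2)"

definition regular_at :: "'p set \<Rightarrow> ('p::finite, 'l::finite, 'm::finite) E_space \<Rightarrow> bool" where
  "regular_at K w \<longleftrightarrow> (\<forall>m. pi3 m w \<noteq> 0) \<and> (\<forall>l m. pi4 l m w \<noteq> 0) \<and>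
    (\<forall>m. invertible (padded K (cov_at m w)))"

text \<open>Operators in \<open>T\<close> that depend on a base point \<open>w\<^sub>0\<close> and a second point \<open>w\<close>. They are found by
  writing the increments from \<open>w\<^sub>0\<close> to \<open>w\<close> as exact linear expressions in \<open>w - w\<^sub>0\<close>: each is the
  limit operator of the theorem at \<open>w\<^sub>0\<close>, with some occurrences of \<open>w\<^sub>0\<close> replaced by \<open>w\<close>. Since they
  are defined for every \<open>w\<close>, degenerate samples need no separate definition.\<close>

definition Lambda_at :: "'p set \<Rightarrow> 'm \<Rightarrow> ('p::finite, 'l::finite, 'm::finite) E_space \<Rightarrow>
    ('p, 'l, 'm) E_space \<Rightarrow> ('p, 'l, 'm) E_space \<Rightarrow> real" where
  "Lambda_at K m w\<^sub>0 w T = (pi3 m w + pi3 m w\<^sub>0) * pi3 m T * xi_at K m w"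

definition Phi_at :: "'p set \<Rightarrow> 'l \<Rightarrow> 'm \<Rightarrow> ('p::finite, 'l::finite, 'm::finite) E_space \<Rightarrow>
    ('p, 'l, 'm) E_space \<Rightarrow> ('p, 'l, 'm) E_space \<Rightarrow> real" where
  "Phi_at K l m w\<^sub>0 w T =
    inverse (pi3 m w) * (pi4 l m T - pi3 m T * cprob_at l m w\<^sub>0) * norm (Delta_at K l m w)"

definition Psi_at :: "'p set \<Rightarrow> 'l \<Rightarrow> 'm \<Rightarrow> ('p::finite, 'l::finite, 'm::finite) E_space \<Rightarrow>
    ('p, 'l, 'm) E_space \<Rightarrow> ('p, 'l, 'm) E_space \<Rightarrow> real ^ 'p" where
  "Psi_at K l m w\<^sub>0 w T =
    (let \<mu> = mean_at m w\<^sub>0; V = cov_at m w\<^sub>0; h = Q_padded K V *v (cmean_at l m w\<^sub>0 - \<mu>);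
         b = pi2 m T - pi3 m T *\<^sub>R \<mu>
     in resid_at K m w *v
          (inverse (pi4 l m w) *\<^sub>R (pi1 l m T - pi4 l m T *\<^sub>R cmean_at l m w\<^sub>0)
           - inverse (pi3 m w) *\<^sub>R b
           - inverse (pi3 m w) *\<^sub>R ((pi5 m T - pi3 m T *\<^sub>R (V + tensor \<mu> \<mu>)) *v h)
           + inverse (pi3 m w) *\<^sub>R (tensor b (mean_at m w) *v h)
           + inverse (pi3 m w) *\<^sub>R (tensor \<mu> b *v h)))"

lemma linear_Lambda_at: "linear (Lambda_at K m w\<^sub>0 w)"
  by (rule linearI) (simp_all add: Lambda_at_def pi_simps algebra_simps)

lemma linear_Phi_at: "linear (Phi_at K l m w\<^sub>0 w)"
  by (rule linearI) (simp_all add: Phi_at_def pi_simps algebra_simps)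

lemma linear_Psi_at: "linear (Psi_at K l m w\<^sub>0 w)"
proof -
  have comp: "linear (\<lambda>T. h (f T))" if "linear h" "linear f" for h f
    using linear_compose[OF that(2,1)] by (simp add: comp_def)
  have scale: "linear (\<lambda>x. x *\<^sub>R v)" for v
    by (rule linear_scaleR_left)
  have eval: "linear (\<lambda>A :: real ^ 'a ^ 'a. A *v h)" for h
    using bounded_bilinear.bounded_linear_left[OF bounded_bilinear_matrix_vector_mult]
    by (rule bounded_linear.linear)
  have tl: "linear (\<lambda>u :: real ^ 'a. tensor u v)" and tr: "linear (\<lambda>u :: real ^ 'a. tensor v u)" for v
    using bounded_bilinear.bounded_linear_left[OF bounded_bilinear_tensor]
      bounded_bilinear.bounded_linear_right[OF bounded_bilinear_tensor]
    by (auto intro: bounded_linear.linear)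
  show ?thesis
    unfolding Psi_at_def Let_def
    by (intro comp[OF matrix_vector_mul_linear] linear_compose_add linear_compose_sub
        linear_compose_scale_right comp[OF eval] comp[OF tl] comp[OF tr] comp[OF scale] linear_pis)
qed

lemma tendsto_at:
  assumes f: "(f \<longlongrightarrow> w\<^sub>0) F" and reg: "regular_at K w\<^sub>0"
  shows tendsto_mean_at: "((\<lambda>x. mean_at m (f x)) \<longlongrightarrow> mean_at m w\<^sub>0) F"
    and tendsto_cmean_at: "((\<lambda>x. cmean_at l m (f x)) \<longlongrightarrow> cmean_at l m w\<^sub>0) F"
    and tendsto_cprob_at: "((\<lambda>x. cprob_at l m (f x)) \<longlongrightarrow> cprob_at l m w\<^sub>0) F"
    and tendsto_cov_at: "((\<lambda>x. cov_at m (f x)) \<longlongrightarrow> cov_at m w\<^sub>0) F"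
    and tendsto_resid_at: "((\<lambda>x. resid_at K m (f x)) \<longlongrightarrow> resid_at K m w\<^sub>0) F"
    and tendsto_Delta_at: "((\<lambda>x. Delta_at K l m (f x)) \<longlongrightarrow> Delta_at K l m w\<^sub>0) F"
    and tendsto_xi_at: "((\<lambda>x. xi_at K m (f x)) \<longlongrightarrow> xi_at K m w\<^sub>0) F"
proof -
  have nz: "pi3 m w\<^sub>0 \<noteq> 0" "pi4 l m w\<^sub>0 \<noteq> 0" "invertible (padded K (cov_at m w\<^sub>0))" for l
    using reg by (simp_all add: regular_at_def)
  show mean: "((\<lambda>x. mean_at m (f x)) \<longlongrightarrow> mean_at m w\<^sub>0) F"
    unfolding mean_at_def by (intro tendsto_intros tendsto_pi f nz)
  have cmean: "((\<lambda>x. cmean_at l m (f x)) \<longlongrightarrow> cmean_at l m w\<^sub>0) F" for l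
    unfolding cmean_at_def by (intro tendsto_intros tendsto_pi f nz)
  then show "((\<lambda>x. cmean_at l m (f x)) \<longlongrightarrow> cmean_at l m w\<^sub>0) F" .
  have cprob: "((\<lambda>x. cprob_at l m (f x)) \<longlongrightarrow> cprob_at l m w\<^sub>0) F" for l
    unfolding cprob_at_def by (intro tendsto_intros tendsto_pi f nz)
  then show "((\<lambda>x. cprob_at l m (f x)) \<longlongrightarrow> cprob_at l m w\<^sub>0) F" .
  show cov: "((\<lambda>x. cov_at m (f x)) \<longlongrightarrow> cov_at m w\<^sub>0) F"
    unfolding cov_at_def by (intro tendsto_intros tendsto_pi tendsto_tensor mean f nz)
  show resid: "((\<lambda>x. resid_at K m (f x)) \<longlongrightarrow> resid_at K m w\<^sub>0) F"
    unfolding resid_at_def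
    by (intro tendsto_diff tendsto_const tendsto_matrix_mult tendsto_Q_padded cov nz)
  have Delta: "((\<lambda>x. Delta_at K l m (f x)) \<longlongrightarrow> Delta_at K l m w\<^sub>0) F" for l
    unfolding Delta_at_def by (intro tendsto_diff tendsto_matrix_vector_mult resid cmean mean)
  then show "((\<lambda>x. Delta_at K l m (f x)) \<longlongrightarrow> Delta_at K l m w\<^sub>0) F" .
  show "((\<lambda>x. xi_at K m (f x)) \<longlongrightarrow> xi_at K m w\<^sub>0) F"
    unfolding xi_at_def by (intro tendsto_intros cprob Delta)
qed

lemma eventually_regular_at:
  fixes w\<^sub>0 :: "('p::finite, 'l::finite, 'm::finite) E_space"
  assumes f: "(f \<longlongrightarrow> w\<^sub>0) F" and reg: "regular_at K w\<^sub>0"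
  shows "\<forall>\<^sub>F x in F. regular_at K (f x)"
proof -
  have "\<forall>\<^sub>F x in F. pi3 m (f x) \<noteq> 0" for m
    using reg tendsto_imp_eventually_ne[OF tendsto_pi(3)[OF f]] by (simp add: regular_at_def)
  moreover have "\<forall>\<^sub>F x in F. pi4 l m (f x) \<noteq> 0" for l m
    using reg tendsto_imp_eventually_ne[OF tendsto_pi(4)[OF f]] by (simp add: regular_at_def)
  moreover have "\<forall>\<^sub>F x in F. invertible (padded K (cov_at m (f x)))" for m
    using reg eventually_invertible_padded[OF tendsto_cov_at[OF f reg]] by (simp add: regular_at_def)
  ultimately show ?thesis
    unfolding regular_at_def by (simp add: eventually_conj_iff eventually_all_finite)
qed

lemma tendsto_Lambda_at:
  assumes f: "(f \<longlongrightarrow> w\<^sub>0) F" and reg: "regular_at K w\<^sub>0"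
  shows "((\<lambda>x. Lambda_at K m w\<^sub>0 (f x) T) \<longlongrightarrow> Lambda_at K m w\<^sub>0 w\<^sub>0 T) F"
  unfolding Lambda_at_def by (intro tendsto_intros tendsto_pi tendsto_at[OF f reg] f)

lemma tendsto_Phi_at:
  assumes f: "(f \<longlongrightarrow> w\<^sub>0) F" and reg: "regular_at K w\<^sub>0"
  shows "((\<lambda>x. Phi_at K l m w\<^sub>0 (f x) T) \<longlongrightarrow> Phi_at K l m w\<^sub>0 w\<^sub>0 T) F"
proof -
  have "pi3 m w\<^sub>0 \<noteq> 0"
    using reg by (simp add: regular_at_def)
  then show ?thesis
    unfolding Phi_at_def by (intro tendsto_intros tendsto_pi tendsto_at[OF f reg] f)
qed

lemma tendsto_Psi_at:
  assumes f: "(f \<longlongrightarrow> w\<^sub>0) F" and reg: "regular_at K w\<^sub>0"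
  shows "((\<lambda>x. Psi_at K l m w\<^sub>0 (f x) T) \<longlongrightarrow> Psi_at K l m w\<^sub>0 w\<^sub>0 T) F"
proof -
  have "pi3 m w\<^sub>0 \<noteq> 0" "pi4 l m w\<^sub>0 \<noteq> 0"
    using reg by (simp_all add: regular_at_def)
  then show ?thesis
    unfolding Psi_at_def Let_def
    by (intro tendsto_add tendsto_diff tendsto_scaleR tendsto_inverse tendsto_const
        tendsto_matrix_vector_mult tendsto_tensor tendsto_pi tendsto_at[OF f reg] f)
qed

lemma borel_measurable_at:
  assumes f: "f \<in> borel_measurable M"
  shows borel_measurable_mean_at: "(\<lambda>x. mean_at m (f x)) \<in> borel_measurable M"
    and borel_measurable_cmean_at: "(\<lambda>x. cmean_at l m (f x)) \<in> borel_measurable M"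
    and borel_measurable_cprob_at: "(\<lambda>x. cprob_at l m (f x)) \<in> borel_measurable M"
    and borel_measurable_resid_at: "(\<lambda>x. resid_at K m (f x)) \<in> borel_measurable M"
    and borel_measurable_Delta_at: "(\<lambda>x. Delta_at K l m (f x)) \<in> borel_measurable M"
    and borel_measurable_xi_at: "(\<lambda>x. xi_at K m (f x)) \<in> borel_measurable M"
proof -
  note [measurable] = borel_measurable_pi[OF f]
  show mean [measurable]: "(\<lambda>x. mean_at m (f x)) \<in> borel_measurable M"
    unfolding mean_at_def by measurable
  have cmean [measurable]: "(\<lambda>x. cmean_at l m (f x)) \<in> borel_measurable M" for l
    unfolding cmean_at_def by measurable
  then show "(\<lambda>x. cmean_at l m (f x)) \<in> borel_measurable M" .
  have cprob [measurable]: "(\<lambda>x. cprob_at l m (f x)) \<in> borel_measurable M" for l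
    unfolding cprob_at_def by measurable
  then show "(\<lambda>x. cprob_at l m (f x)) \<in> borel_measurable M" .
  have [measurable]: "(\<lambda>x. tensor (mean_at m (f x)) (mean_at m (f x))) \<in> borel_measurable M"
    by (intro borel_measurable_tensor mean)
  have cov: "(\<lambda>x. cov_at m (f x)) \<in> borel_measurable M"
    unfolding cov_at_def by measurable
  show resid: "(\<lambda>x. resid_at K m (f x)) \<in> borel_measurable M"
    unfolding resid_at_def
    by (intro borel_measurable_diff borel_measurable_const borel_measurable_matrix_mult
        borel_measurable_Q_padded cov)
  have Delta [measurable]: "(\<lambda>x. Delta_at K l m (f x)) \<in> borel_measurable M" for l
    unfolding Delta_at_def
    by (intro borel_measurable_matrix_vector_mult borel_measurable_diff resid cmean mean)
  then show "(\<lambda>x. Delta_at K l m (f x)) \<in> borel_measurable M" .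
  show "(\<lambda>x. xi_at K m (f x)) \<in> borel_measurable M"
    unfolding xi_at_def by measurable
qed

lemma borel_measurable_operators_at:
  assumes f: "f \<in> borel_measurable M"
  shows borel_measurable_Lambda_at: "(\<lambda>x. Lambda_at K m w\<^sub>0 (f x) T) \<in> borel_measurable M"
    and borel_measurable_Phi_at: "(\<lambda>x. Phi_at K l m w\<^sub>0 (f x) T) \<in> borel_measurable M"
    and borel_measurable_Psi_at: "(\<lambda>x. Psi_at K l m w\<^sub>0 (f x) T) \<in> borel_measurable M"
proof -
  note [measurable] = borel_measurable_pi[OF f] borel_measurable_at[OF f]
  show "(\<lambda>x. Lambda_at K m w\<^sub>0 (f x) T) \<in> borel_measurable M"
    unfolding Lambda_at_def by measurable
  show "(\<lambda>x. Phi_at K l m w\<^sub>0 (f x) T) \<in> borel_measurable M"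
    unfolding Phi_at_def by measurable
  show "(\<lambda>x. Psi_at K l m w\<^sub>0 (f x) T) \<in> borel_measurable M"
    unfolding Psi_at_def Let_def
    by (intro borel_measurable_add borel_measurable_diff borel_measurable_scaleR
        borel_measurable_inverse borel_measurable_const borel_measurable_matrix_vector_mult
        borel_measurable_tensor borel_measurable_pi borel_measurable_at f)
qed

text \<open>With \<open>\<rho> = a\<^sub>0 / c\<^sub>0\<close>, this is \<open>r\<close> times \<open>a / c - \<rho> = ((a - a\<^sub>0) - (c - c\<^sub>0) \<rho>) / c\<close>, true because
  \<open>a\<^sub>0 - c\<^sub>0 \<rho> = 0\<close>. The right-hand side is linear in the increments, without remainder, and only
  its factor \<open>1 / c\<close> involves the second point.\<close>

lemma ratio_increment:
  fixes a a\<^sub>0 :: "'v::real_vector"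
  assumes "c \<noteq> 0" "c\<^sub>0 \<noteq> 0"
  shows "inverse c *\<^sub>R (r *\<^sub>R (a - a\<^sub>0) - (r * (c - c\<^sub>0)) *\<^sub>R (1 / c\<^sub>0) *\<^sub>R a\<^sub>0)
    = r *\<^sub>R ((1 / c) *\<^sub>R a - (1 / c\<^sub>0) *\<^sub>R a\<^sub>0)"
proof -
  have "inverse c * r + inverse c * (r * (c - c\<^sub>0) * (1 / c\<^sub>0)) = r * (1 / c\<^sub>0)"
    using assms by (simp add: field_simps)
  then have "(inverse c * r + inverse c * (r * (c - c\<^sub>0) * (1 / c\<^sub>0))) *\<^sub>R a\<^sub>0 = (r * (1 / c\<^sub>0)) *\<^sub>R a\<^sub>0"
    by (rule arg_cong)
  then show ?thesis
    by (simp add: scaleR_diff_right scaleR_add_left inverse_eq_divide mult.commute)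
      (simp add: algebra_simps)
qed

lemma Phi_at_increment:
  assumes "regular_at K w" "regular_at K w\<^sub>0"
  shows "Phi_at K l m w\<^sub>0 w (r *\<^sub>R (w - w\<^sub>0))
    = r * (cprob_at l m w - cprob_at l m w\<^sub>0) * norm (Delta_at K l m w)"
proof -
  have nz: "pi3 m w \<noteq> 0" "pi3 m w\<^sub>0 \<noteq> 0"
    using assms by (simp_all add: regular_at_def)
  show ?thesis
    using ratio_increment[OF nz, of r "pi4 l m w" "pi4 l m w\<^sub>0"]
    by (simp add: Phi_at_def cprob_at_def pi_simps)
qed

text \<open>The increment of \<open>\<Delta> = (I - V Q) \<delta>\<close> with \<open>\<delta> = \<mu>\<^sub>\<ell>\<^sub>,\<^sub>m - \<mu>\<^sub>m\<close>. Denoting values at \<open>w\<close> by primes,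
  \<open>\<Delta>' - \<Delta> = (I - V' Q') (\<delta>' - \<delta> - (V' - V) Q \<delta>)\<close> by \<open>oblique_projection_difference\<close>. The means and
  \<open>V + \<mu> \<otimes> \<mu>\<close> are ratios, and
  \<open>\<mu>' \<otimes> \<mu>' - \<mu> \<otimes> \<mu> = (\<mu>' - \<mu>) \<otimes> \<mu>' + \<mu> \<otimes> (\<mu>' - \<mu>)\<close> accounts for the last two summands of
  \<open>Psi_at\<close>.\<close>

lemma Psi_at_increment:
  assumes reg: "regular_at K w" "regular_at K w\<^sub>0"
  shows "Psi_at K l m w\<^sub>0 w (r *\<^sub>R (w - w\<^sub>0)) = r *\<^sub>R (Delta_at K l m w - Delta_at K l m w\<^sub>0)"
proof -
  have nz: "pi3 m w \<noteq> 0" "pi3 m w\<^sub>0 \<noteq> 0" "pi4 l m w \<noteq> 0" "pi4 l m w\<^sub>0 \<noteq> 0"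
    "invertible (padded K (cov_at m w))" "invertible (padded K (cov_at m w\<^sub>0))"
    using assms by (simp_all add: regular_at_def)
  define \<mu> where "\<mu> = mean_at m w\<^sub>0"
  define \<mu>' where "\<mu>' = mean_at m w"
  define V where "V = cov_at m w\<^sub>0"
  define V' where "V' = cov_at m w"
  define R where "R = resid_at K m w"
  define \<delta> where "\<delta> = cmean_at l m w\<^sub>0 - \<mu>"
  define \<delta>' where "\<delta>' = cmean_at l m w - \<mu>'"
  define h where "h = Q_padded K V *v \<delta>"
  define T where "T = r *\<^sub>R (w - w\<^sub>0)"
  define b where "b = pi2 m T - pi3 m T *\<^sub>R \<mu>"
  have V_plus: "V + tensor \<mu> \<mu> = (1 / pi3 m w\<^sub>0) *\<^sub>R pi5 m w\<^sub>0"
    and V'_plus: "V' + tensor \<mu>' \<mu>' = (1 / pi3 m w) *\<^sub>R pi5 m w"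
    by (simp_all add: V_def V'_def \<mu>_def \<mu>'_def cov_at_def)
  have a: "inverse (pi4 l m w) *\<^sub>R (pi1 l m T - pi4 l m T *\<^sub>R cmean_at l m w\<^sub>0)
      = r *\<^sub>R (cmean_at l m w - cmean_at l m w\<^sub>0)"
    using ratio_increment[OF nz(3,4), of r "pi1 l m w" "pi1 l m w\<^sub>0"]
    by (simp add: T_def cmean_at_def pi_simps)
  have b_eq: "inverse (pi3 m w) *\<^sub>R b = r *\<^sub>R (\<mu>' - \<mu>)"
    using ratio_increment[OF nz(1,2), of r "pi2 m w" "pi2 m w\<^sub>0"]
    by (simp add: b_def T_def \<mu>_def \<mu>'_def mean_at_def pi_simps)
  have e: "inverse (pi3 m w) *\<^sub>R (pi5 m T - pi3 m T *\<^sub>R (V + tensor \<mu> \<mu>))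
      = r *\<^sub>R ((V' + tensor \<mu>' \<mu>') - (V + tensor \<mu> \<mu>))"
    using ratio_increment[OF nz(1,2), of r "pi5 m w" "pi5 m w\<^sub>0"]
    unfolding V_plus V'_plus by (simp add: T_def pi_simps)
  note apply_simps = bounded_bilinear.scaleR_left[OF bounded_bilinear_matrix_vector_mult]
    bounded_bilinear.scaleR_right[OF bounded_bilinear_matrix_vector_mult]
  have "Psi_at K l m w\<^sub>0 w T = R *v
      (inverse (pi4 l m w) *\<^sub>R (pi1 l m T - pi4 l m T *\<^sub>R cmean_at l m w\<^sub>0)
       - inverse (pi3 m w) *\<^sub>R b
       - (inverse (pi3 m w) *\<^sub>R (pi5 m T - pi3 m T *\<^sub>R (V + tensor \<mu> \<mu>))) *v h
       + tensor (inverse (pi3 m w) *\<^sub>R b) \<mu>' *v h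
       + tensor \<mu> (inverse (pi3 m w) *\<^sub>R b) *v h)"
    by (simp add: Psi_at_def Let_def R_def h_def b_def \<mu>_def \<mu>'_def \<delta>_def V_def
        bounded_bilinear.scaleR_left[OF bounded_bilinear_tensor]
        bounded_bilinear.scaleR_right[OF bounded_bilinear_tensor] apply_simps)
  also have "\<dots> = R *v (r *\<^sub>R (\<delta>' - \<delta> - (V' - V) *v h))"
  proof (rule arg_cong[where f = "\<lambda>v. R *v v"])
    have "(r *\<^sub>R ((V' + tensor \<mu>' \<mu>') - (V + tensor \<mu> \<mu>))) *v h
        = r *\<^sub>R ((V' - V) *v h + (\<mu>' \<bullet> h) *\<^sub>R \<mu>' - (\<mu> \<bullet> h) *\<^sub>R \<mu>)"
      by (simp add: apply_simps tensor_apply matrix_vector_mult_add_rdistrib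
          matrix_vector_mult_diff_rdistrib algebra_simps)
    then show "inverse (pi4 l m w) *\<^sub>R (pi1 l m T - pi4 l m T *\<^sub>R cmean_at l m w\<^sub>0)
       - inverse (pi3 m w) *\<^sub>R b
       - (inverse (pi3 m w) *\<^sub>R (pi5 m T - pi3 m T *\<^sub>R (V + tensor \<mu> \<mu>))) *v h
       + tensor (inverse (pi3 m w) *\<^sub>R b) \<mu>' *v h
       + tensor \<mu> (inverse (pi3 m w) *\<^sub>R b) *v h = r *\<^sub>R (\<delta>' - \<delta> - (V' - V) *v h)"
      unfolding a b_eq e
      by (simp add: tensor_apply \<delta>_def \<delta>'_def inner_diff_left algebra_simps)
  qed
  also have "\<dots> = r *\<^sub>R (R *v \<delta>' - (R *v \<delta> + R *v ((V' - V) *v h)))"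
    by (simp add: apply_simps matrix_vector_mult_diff_distrib)
  also have "R *v ((V' - V) *v h) = (V' ** Q_padded K V' - V ** Q_padded K V) *v \<delta>"
    using oblique_projection_difference[OF nz(6,5)]
    by (simp add: R_def resid_at_def h_def V_def V'_def matrix_vector_mul_assoc matrix_mul_assoc)
  also have "R *v \<delta> + (V' ** Q_padded K V' - V ** Q_padded K V) *v \<delta> = resid_at K m w\<^sub>0 *v \<delta>"
    by (simp add: R_def resid_at_def V_def V'_def matrix_vector_mult_diff_rdistrib)
  finally show ?thesis
    by (simp add: T_def R_def Delta_at_def \<delta>_def \<delta>'_def \<mu>_def \<mu>'_def)
qed

text \<open>With \<open>p\<close> for \<open>pi3\<close> at \<open>w\<close> and \<open>p\<^sub>0\<close> at \<open>w\<^sub>0\<close>, the factor \<open>p\<^sup>2\<close> is split as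
  \<open>(p + p\<^sub>0) (p - p\<^sub>0) + p\<^sub>0\<^sup>2\<close>. The first part is the \<open>Lambda_at\<close> term. In the second,
  the norm of \<open>Delta_at\<close> times the conditional probability at \<open>w\<close> is the increment of the probability
  times that norm, which is \<open>Phi_at\<close>, plus the probability at \<open>w\<^sub>0\<close> times the same norm, in which
  \<open>Delta_at\<close> is recovered from \<open>Psi_at\<close> and its value at \<open>w\<^sub>0\<close>.\<close>

lemma xi_at_decomposition:
  fixes w w\<^sub>0 :: "('p::finite, 'l::finite, 'm::finite) E_space"
  assumes reg: "regular_at K w" "regular_at K w\<^sub>0" and r: "0 \<le> r"
  defines "T \<equiv> r *\<^sub>R (w - w\<^sub>0)"
  shows "r\<^sup>2 * (\<Sum>m\<in>UNIV. (pi3 m w)\<^sup>2 * xi_at K m w)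
    = (\<Sum>m\<in>UNIV. r * Lambda_at K m w\<^sub>0 w T) +
      (\<Sum>m\<in>UNIV. \<Sum>l\<in>UNIV. (pi3 m w\<^sub>0 * Phi_at K l m w\<^sub>0 w T +
         pi3 m w\<^sub>0 * cprob_at l m w\<^sub>0 *
           norm (Psi_at K l m w\<^sub>0 w T + r *\<^sub>R Delta_at K l m w\<^sub>0))\<^sup>2)"
proof -
  \<comment> \<open>inside the square, \<open>Phi_at\<close> turns the probability at \<open>w\<^sub>0\<close> into the one at \<open>w\<close>\<close>
  have square: "(pi3 m w\<^sub>0 * Phi_at K l m w\<^sub>0 w T + pi3 m w\<^sub>0 * cprob_at l m w\<^sub>0 *
         norm (Psi_at K l m w\<^sub>0 w T + r *\<^sub>R Delta_at K l m w\<^sub>0))\<^sup>2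
      = r\<^sup>2 * (pi3 m w\<^sub>0)\<^sup>2 * ((cprob_at l m w)\<^sup>2 * (norm (Delta_at K l m w))\<^sup>2)" for l m
  proof -
    have "norm (Psi_at K l m w\<^sub>0 w T + r *\<^sub>R Delta_at K l m w\<^sub>0) = r * norm (Delta_at K l m w)"
      using r by (simp add: T_def Psi_at_increment[OF reg] flip: scaleR_add_right)
    moreover have "Phi_at K l m w\<^sub>0 w T
        = r * (cprob_at l m w - cprob_at l m w\<^sub>0) * norm (Delta_at K l m w)"
      unfolding T_def by (rule Phi_at_increment[OF reg])
    ultimately have "pi3 m w\<^sub>0 * Phi_at K l m w\<^sub>0 w T + pi3 m w\<^sub>0 * cprob_at l m w\<^sub>0 *
         norm (Psi_at K l m w\<^sub>0 w T + r *\<^sub>R Delta_at K l m w\<^sub>0)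
       = r * pi3 m w\<^sub>0 * (cprob_at l m w * norm (Delta_at K l m w))"
      by (simp only:) (simp add: algebra_simps)
    then show ?thesis
      by (simp only: power_mult_distrib)
  qed
  have "r * Lambda_at K m w\<^sub>0 w T
      + (\<Sum>l\<in>UNIV. r\<^sup>2 * (pi3 m w\<^sub>0)\<^sup>2 * ((cprob_at l m w)\<^sup>2 * (norm (Delta_at K l m w))\<^sup>2))
      = r\<^sup>2 * ((pi3 m w)\<^sup>2 * xi_at K m w)" for m
    unfolding sum_distrib_left[symmetric] xi_at_def[symmetric] Lambda_at_def
    by (simp add: T_def pi_simps power2_eq_square algebra_simps)
  then show ?thesis
    unfolding square sum_distrib_left[of "r\<^sup>2"] by (simp flip: sum.distrib)
qed

section \<open>The estimators as functions of the sample mean\<close>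

lemma pi_W_of [simp]:
  "pi1 l m (W_of x u z) = of_bool (z = l \<and> u = m) *\<^sub>R x"
  "pi2 m (W_of x u z) = of_bool (u = m) *\<^sub>R x"
  "pi3 m (W_of x u z) = of_bool (u = m)"
  "pi4 l m (W_of x u z) = of_bool (z = l \<and> u = m)"
  "pi5 m (W_of x u z) = of_bool (u = m) *\<^sub>R tensor x x"
  by (simp_all add: W_of_def pi1_def pi2_def pi3_def pi4_def pi5_def)

lemma tensor_diff_diff:
  "tensor (x - y) (x - y) = tensor x x - tensor x y - tensor y x + tensor y y"
  by (simp add: bounded_bilinear.diff_left[OF bounded_bilinear_tensor]
      bounded_bilinear.diff_right[OF bounded_bilinear_tensor])

definition W_mean :: "nat \<Rightarrow> (nat \<Rightarrow> real ^ 'p) \<Rightarrow> (nat \<Rightarrow> 'm) \<Rightarrow> (nat \<Rightarrow> 'l) \<Rightarrow>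
    ('p::finite, 'l::finite, 'm::finite) E_space" where
  "W_mean n x u z = (1 / real n) *\<^sub>R (\<Sum>i=1..n. W_of (x i) (u i) (z i))"

lemma pi_W_mean:
  "pi1 l m (W_mean n x u z) = (1 / real n) *\<^sub>R (\<Sum>i=1..n. of_bool (z i = l \<and> u i = m) *\<^sub>R x i)"
  "pi2 m (W_mean n x u z) = (1 / real n) *\<^sub>R (\<Sum>i=1..n. of_bool (u i = m) *\<^sub>R x i)"
  "pi3 m (W_mean n x u z) = N_U n u m / real n"
  "pi4 l m (W_mean n x u z) = N_ZU n u z l m / real n"
  "pi5 m (W_mean n x u z) = (1 / real n) *\<^sub>R (\<Sum>i=1..n. of_bool (u i = m) *\<^sub>R tensor (x i) (x i))"
  by (simp_all add: W_mean_def N_U_def N_ZU_def linear_scale[OF linear_pi1] linear_scale[OF linear_pi2]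
      linear_scale[OF linear_pi3] linear_scale[OF linear_pi4] linear_scale[OF linear_pi5]
      linear_sum[OF linear_pi1] linear_sum[OF linear_pi2]
      linear_sum[OF linear_pi3] linear_sum[OF linear_pi4] linear_sum[OF linear_pi5])

lemma hat_eq_at:
  assumes "n \<noteq> 0"
  shows p_U_hat_eq: "p_U_hat n u m = pi3 m (W_mean n x u z)"
    and p_ZU_hat_eq: "p_ZU_hat n u z l m = cprob_at l m (W_mean n x u z)"
    and mu_U_hat_eq: "mu_U_hat n x u m = mean_at m (W_mean n x u z)"
    and mu_ZU_hat_eq: "mu_ZU_hat n x u z l m = cmean_at l m (W_mean n x u z)"
  using assms
  by (simp_all add: p_U_hat_def p_ZU_hat_def mu_U_hat_def mu_ZU_hat_def cprob_at_def mean_at_def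
      cmean_at_def pi_W_mean)

text \<open>When the tensor square is expanded, each of the two cross terms sums to \<open>- N \<mu> \<otimes> \<mu>\<close> and the
  constant term to \<open>N \<mu> \<otimes> \<mu>\<close>, where \<open>\<mu>\<close> is the sample mean in the stratum and \<open>N\<close> the size of
  the stratum.\<close>

lemma V_U_hat_eq:
  assumes n: "n \<noteq> 0" and N: "N_U n u m \<noteq> 0"
  shows "V_U_hat n x u m = cov_at m (W_mean n x u z)"
proof -
  let ?N = "N_U n u m" and ?\<mu> = "mu_U_hat n x u m"
  note bil = bounded_bilinear_tensor
  have mean: "(\<Sum>i=1..n. of_bool (u i = m) *\<^sub>R x i) = ?N *\<^sub>R ?\<mu>"
    using N by (simp add: mu_U_hat_def)
  have "(\<Sum>i=1..n. of_bool (u i = m) *\<^sub>R tensor (x i - ?\<mu>) (x i - ?\<mu>))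
      = (\<Sum>i=1..n. of_bool (u i = m) *\<^sub>R tensor (x i) (x i)
          - tensor (of_bool (u i = m) *\<^sub>R x i) ?\<mu> - tensor ?\<mu> (of_bool (u i = m) *\<^sub>R x i)
          + of_bool (u i = m) *\<^sub>R tensor ?\<mu> ?\<mu>)"
    by (intro sum.cong refl) (simp add: tensor_diff_diff algebra_simps bounded_bilinear.scaleR_left[OF bil]
        bounded_bilinear.scaleR_right[OF bil])
  also have "\<dots> = (\<Sum>i=1..n. of_bool (u i = m) *\<^sub>R tensor (x i) (x i))
      - tensor (\<Sum>i=1..n. of_bool (u i = m) *\<^sub>R x i) ?\<mu>
      - tensor ?\<mu> (\<Sum>i=1..n. of_bool (u i = m) *\<^sub>R x i) + ?N *\<^sub>R tensor ?\<mu> ?\<mu>"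
    by (simp only: sum.distrib sum_subtractf N_U_def scaleR_sum_left
        bounded_bilinear.sum_left[OF bil] bounded_bilinear.sum_right[OF bil])
  also have "\<dots> = (\<Sum>i=1..n. of_bool (u i = m) *\<^sub>R tensor (x i) (x i)) - ?N *\<^sub>R tensor ?\<mu> ?\<mu>"
    unfolding mean
    by (simp add: bounded_bilinear.scaleR_left[OF bil] bounded_bilinear.scaleR_right[OF bil])
  finally have "V_U_hat n x u m
      = (1 / ?N) *\<^sub>R (\<Sum>i=1..n. of_bool (u i = m) *\<^sub>R tensor (x i) (x i)) - tensor ?\<mu> ?\<mu>"
    using N by (simp add: V_U_hat_def scaleR_diff_right)
  then show ?thesis
    using n by (simp add: cov_at_def pi_W_mean mu_U_hat_eq[OF n, where z = z])
qed

lemma estimators_defined_iff: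
  fixes K :: "'p::finite set"
  assumes "n \<noteq> 0"
  shows "estimators_defined n x u z K \<longleftrightarrow> regular_at K (W_mean n x u z)"
  using assms by (auto simp: estimators_defined_def regular_at_def pi_W_mean compress_invertible_iff
      V_U_hat_eq[where z = z])

lemma xi_hat_eq:
  fixes K :: "'p::finite set"
  assumes "estimators_defined n x u z K"
  shows "xi_hat n x u z K = (\<Sum>m\<in>UNIV. (pi3 m (W_mean n x u z))\<^sup>2 * xi_at K m (W_mean n x u z))"
proof -
  have n: "n \<noteq> 0" and N: "N_U n u m \<noteq> 0" and inv: "compress_invertible K (V_U_hat n x u m)" for m
    using assms by (simp_all add: estimators_defined_def)
  have Q: "Q_op K (cov_at m (W_mean n x u z)) = Q_padded K (cov_at m (W_mean n x u z))" for m
    using Q_op_eq_Q_padded[OF inv[of m]] by (simp add: V_U_hat_eq[OF n N, where x = x and z = z])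
  show ?thesis
    by (simp add: xi_hat_def xi_cond_hat_def xi_at_def Delta_at_def resid_at_def Q
        V_U_hat_eq[OF n N, where x = x and z = z] p_U_hat_eq[OF n, where x = x and z = z]
        p_ZU_hat_eq[OF n, where x = x] mu_U_hat_eq[OF n, where z = z] mu_ZU_hat_eq[OF n])
qed

section \<open>Moments of the observation vector\<close>

lemma borel_measurable_W_of:
  assumes [measurable]: "X \<in> borel_measurable M" "U \<in> measurable M (count_space UNIV)"
    "Z \<in> measurable M (count_space UNIV)"
  shows "(\<lambda>\<omega>. W_of (X \<omega>) (U \<omega>) (Z \<omega>) :: ('p::finite, 'l::finite, 'm::finite) E_space) \<in> borel_measurable M"
proof -
  have [measurable]: "(\<lambda>\<omega>. of_bool (Z \<omega> = l \<and> U \<omega> = m) :: real) \<in> borel_measurable M"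
    "(\<lambda>\<omega>. of_bool (U \<omega> = m) :: real) \<in> borel_measurable M" for l m
    unfolding of_bool_def by measurable
  have [measurable]: "(\<lambda>\<omega>. tensor (X \<omega>) (X \<omega>)) \<in> borel_measurable M"
    by (rule borel_measurable_tensor) measurable
  have [measurable]: "(\<lambda>\<omega>. X \<omega> $ i) \<in> borel_measurable M"
    "(\<lambda>\<omega>. tensor (X \<omega>) (X \<omega>) $ i $ j) \<in> borel_measurable M" for i j
    by (rule borel_measurable_vec_nth borel_measurable_matrix_nth, measurable)+
  show ?thesis
    unfolding W_of_def
    by (intro borel_measurable_Pair borel_measurable_vecI; simp; measurable)
qed

text \<open>The blocks of \<open>W_of\<close> are of degree at most two in \<open>x\<close>, so that a fourth moment of \<open>X\<close> is a second
  moment of \<open>W_of X U Z\<close>.\<close>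

lemma norm_W_of_le:
  "\<exists>C\<ge>0. \<forall>x u z. norm (W_of x u z :: ('p::finite, 'l::finite, 'm::finite) E_space) \<le> C * (1 + (norm x)\<^sup>2)"
proof -
  obtain B where B: "0 \<le> B" "\<And>x y :: real ^ 'p. norm (tensor x y) \<le> norm x * norm y * B"
    using bounded_bilinear.nonneg_bounded[OF bounded_bilinear_tensor[where 'p = 'p]] by blast
  define l where "l = real CARD('l)"
  define k where "k = real CARD('m)"
  have vec_le: "norm v \<le> real CARD('n) * c" if "\<And>i. norm (v $ i) \<le> c"
    for v :: "'v::real_normed_vector ^ 'n::finite" and c
  proof -
    have "norm v \<le> (\<Sum>i\<in>UNIV. norm (v $ i))"
      unfolding norm_vec_def by (rule L2_set_le_sum) simp
    also have "\<dots> \<le> (\<Sum>i\<in>(UNIV :: 'n set). c)"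
      by (intro sum_mono that)
    finally show ?thesis by simp
  qed
  have bound: "norm (W_of x u z :: ('p, 'l, 'm) E_space) \<le> (2 * l * k + 2 * k + k * B) * (1 + (norm x)\<^sup>2)"
    (is "_ \<le> _ * ?s") for x u z
  proof -
    have "2 * norm x \<le> ?s"
      using sum_squares_bound[of 1 "norm x"] by simp
    then have s: "norm x \<le> ?s" "1 \<le> ?s"
      using norm_ge_zero[of x] by (linarith, simp)
    have s0: "0 \<le> ?s" using s by linarith
    have e: "norm (tensor x x) \<le> B * ?s"
    proof -
      have "norm (tensor x x) \<le> B * (norm x)\<^sup>2"
        using B(2)[of x x] by (simp add: power2_eq_square mult.commute)
      also have "\<dots> \<le> B * ?s"
        using B(1) by (intro mult_left_mono) auto
      finally show ?thesis .
    qed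
    obtain a b c d e where W: "(W_of x u z :: ('p, 'l, 'm) E_space) = (a, b, c, d, e)"
      by (cases "W_of x u z :: ('p, 'l, 'm) E_space")
    have nth: "a $ i $ j = of_bool (z = i \<and> u = j) *\<^sub>R x" "b $ j = of_bool (u = j) *\<^sub>R x"
      "c $ j = of_bool (u = j)" "d $ i $ j = of_bool (z = i \<and> u = j)"
      "e $ j = of_bool (u = j) *\<^sub>R tensor x x" for i j
      using W by (auto simp: W_of_def)
    have "norm a \<le> l * (k * ?s)" "norm d \<le> l * (k * ?s)" "norm b \<le> k * ?s" "norm c \<le> k * ?s"
      "norm e \<le> k * (B * ?s)"
      unfolding l_def k_def
      using s s0 e B(1) by (auto intro!: vec_le simp: nth of_bool_def)
    moreover have "norm (W_of x u z :: ('p, 'l, 'm) E_space) \<le> norm a + (norm b + (norm c + (norm d + norm e)))"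
      unfolding W by (intro order_trans[OF norm_Pair_le] add_left_mono order_refl)
    ultimately have "norm (W_of x u z :: ('p, 'l, 'm) E_space)
        \<le> l * (k * ?s) + (k * ?s + (k * ?s + (l * (k * ?s) + k * (B * ?s))))"
      by linarith
    also have "\<dots> = (2 * l * k + 2 * k + k * B) * ?s"
      by (simp add: algebra_simps)
    finally show ?thesis .
  qed
  have "0 \<le> 2 * l * k + 2 * k + k * B"
    using B(1) by (simp add: l_def k_def)
  with bound show ?thesis by blast
qed

context prob_space
begin

lemma square_integrable_W_of:
  assumes [measurable]: "X \<in> borel_measurable M" "U \<in> measurable M (count_space UNIV)"
      "Z \<in> measurable M (count_space UNIV)"
    and moment: "integrable M (\<lambda>\<omega>. norm (X \<omega>) ^ 4)"
  shows "integrable M (\<lambda>\<omega>. (norm (W_of (X \<omega>) (U \<omega>) (Z \<omega>) :: ('p::finite, 'l::finite, 'm::finite) E_space))\<^sup>2)"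
proof -
  obtain C where C: "0 \<le> C"
    "\<And>x u z. norm (W_of x u z :: ('p, 'l, 'm) E_space) \<le> C * (1 + (norm x)\<^sup>2)"
    using norm_W_of_le by blast
  show ?thesis
  proof (rule Bochner_Integration.integrable_bound)
    show "integrable M (\<lambda>\<omega>. 2 * C\<^sup>2 * (1 + norm (X \<omega>) ^ 4))"
      using moment by simp
    have "(norm (W_of x u z :: ('p, 'l, 'm) E_space))\<^sup>2 \<le> 2 * C\<^sup>2 * (1 + norm x ^ 4)" for x u z
    proof -
      have "(norm (W_of x u z :: ('p, 'l, 'm) E_space))\<^sup>2 \<le> (C * (1 + (norm x)\<^sup>2))\<^sup>2"
        using C(2) by (intro power_mono) auto
      also have "\<dots> = C\<^sup>2 * (1 + 2 * (norm x)\<^sup>2 + norm x ^ 4)"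
        by (simp add: power_mult_distrib power2_sum)
      also have "\<dots> \<le> C\<^sup>2 * (2 * (1 + norm x ^ 4))"
        using sum_squares_bound[of 1 "(norm x)\<^sup>2"] by (intro mult_left_mono) auto
      finally show ?thesis by (simp add: algebra_simps)
    qed
    then show "AE \<omega> in M. norm ((norm (W_of (X \<omega>) (U \<omega>) (Z \<omega>) :: ('p, 'l, 'm) E_space))\<^sup>2)
        \<le> norm (2 * C\<^sup>2 * (1 + norm (X \<omega>) ^ 4))"
      by (auto intro!: AE_I2 order_trans[OF _ abs_ge_self])
  qed (use borel_measurable_W_of[OF assms(1-3)] in measurable)
qed

lemma cexp_eq: "cexp M A f = (1 / prob {\<omega>\<in>space M. A \<omega>}) *\<^sub>R expectation (\<lambda>\<omega>. of_bool (A \<omega>) *\<^sub>R f \<omega>)"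
  unfolding cexp_def set_lebesgue_integral_def
  by (intro arg_cong2[where f = scaleR] refl Bochner_Integration.integral_cong) (auto simp: indicator_def)

end

section \<open>The parameters as functions of the population mean\<close>

text \<open>The population, stratified by \<open>U\<close>, which takes values in any finite type; the theorem is about the
  case that \<open>U\<close> numbers the elements of \<open>{0,1}\<^sup>d\<close>.\<close>

locale sampling_model = prob_space P for P :: "'a measure" +
  fixes X :: "'a \<Rightarrow> real ^ 'p::finite" and U :: "'a \<Rightarrow> 'm::finite" and Z :: "'a \<Rightarrow> 'l::finite"
  assumes X_meas [measurable]: "X \<in> borel_measurable P"
    and U_meas [measurable]: "U \<in> measurable P (count_space UNIV)"
    and Z_meas [measurable]: "Z \<in> measurable P (count_space UNIV)"
    and X_moment: "integrable P (\<lambda>\<omega>. norm (X \<omega>) ^ 4)"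
    and p_U_pos: "\<And>m. p_U P U m > 0"
    and p_ZU_pos: "\<And>l m. p_ZU P U Z l m > 0"
    and V_inv: "\<And>m. invertible (V_U P X U m)"
begin

definition W_exp :: "('p, 'l, 'm) E_space" where
  "W_exp = expectation (\<lambda>\<omega>. W_of (X \<omega>) (U \<omega>) (Z \<omega>))"

lemma integrable_W_of: "integrable P (\<lambda>\<omega>. W_of (X \<omega>) (U \<omega>) (Z \<omega>) :: ('p, 'l, 'm) E_space)"
proof -
  have [measurable]: "(\<lambda>\<omega>. W_of (X \<omega>) (U \<omega>) (Z \<omega>) :: ('p, 'l, 'm) E_space) \<in> borel_measurable P"
    by (rule borel_measurable_W_of) measurable
  show ?thesis
    by (subst integrable_norm_iff[symmetric])
      (auto intro: integrable_if_square_integrable square_integrable_W_of[OF X_meas U_meas Z_meas X_moment])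
qed

lemma integrable_linear_W_of:
  fixes h :: "('p, 'l, 'm) E_space \<Rightarrow> 'c::euclidean_space"
  assumes "linear h"
  shows "integrable P (\<lambda>\<omega>. h (W_of (X \<omega>) (U \<omega>) (Z \<omega>)))"
    and "expectation (\<lambda>\<omega>. h (W_of (X \<omega>) (U \<omega>) (Z \<omega>))) = h W_exp"
  using integrable_bounded_linear[OF _ integrable_W_of, of h] assms
    integral_bounded_linear[OF _ integrable_W_of, of h]
  by (simp_all add: W_exp_def linear_conv_bounded_linear)

lemmas integrable_pi =
  linear_pi1[THEN integrable_linear_W_of(1), unfolded pi_W_of]
  linear_pi2[THEN integrable_linear_W_of(1), unfolded pi_W_of]
  linear_pi3[THEN integrable_linear_W_of(1), unfolded pi_W_of]
  linear_pi4[THEN integrable_linear_W_of(1), unfolded pi_W_of]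
  linear_pi5[THEN integrable_linear_W_of(1), unfolded pi_W_of]

lemmas pi_W_exp =
  linear_pi1[THEN integrable_linear_W_of(2), unfolded pi_W_of, symmetric]
  linear_pi2[THEN integrable_linear_W_of(2), unfolded pi_W_of, symmetric]
  linear_pi3[THEN integrable_linear_W_of(2), unfolded pi_W_of, symmetric]
  linear_pi4[THEN integrable_linear_W_of(2), unfolded pi_W_of, symmetric]
  linear_pi5[THEN integrable_linear_W_of(2), unfolded pi_W_of, symmetric]

lemma expectation_of_bool:
  "Measurable.pred P A \<Longrightarrow> expectation (\<lambda>\<omega>. of_bool (A \<omega>)) = prob {\<omega>\<in>space P. A \<omega>}"
proof -
  assume [measurable]: "Measurable.pred P A"
  have "expectation (\<lambda>\<omega>. of_bool (A \<omega>)) = expectation (indicator {\<omega>\<in>space P. A \<omega>})"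
    by (intro Bochner_Integration.integral_cong) (auto simp: indicator_def)
  also have "\<dots> = prob {\<omega>\<in>space P. A \<omega>}"
    by simp
  finally show ?thesis .
qed

lemma pi3_W_exp: "pi3 m W_exp = p_U P U m"
  by (simp add: pi_W_exp p_U_def expectation_of_bool)

lemma pi4_W_exp: "pi4 l m W_exp = prob {\<omega>\<in>space P. Z \<omega> = l \<and> U \<omega> = m}"
  by (simp add: pi_W_exp expectation_of_bool)

lemma cprob_at_W_exp: "cprob_at l m W_exp = p_ZU P U Z l m"
  by (simp add: cprob_at_def pi4_W_exp pi3_W_exp p_ZU_def p_U_def cond_prob_def)

lemma pi4_W_exp_factor: "pi4 l m W_exp = p_U P U m * p_ZU P U Z l m"
  using p_U_pos[of m] by (simp flip: cprob_at_W_exp pi3_W_exp add: cprob_at_def)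

lemma mean_at_W_exp: "mean_at m W_exp = mu_U P X U m"
  unfolding mean_at_def pi3_W_exp by (simp add: mu_U_def cexp_eq p_U_def pi_W_exp)

lemma cmean_at_W_exp: "cmean_at l m W_exp = mu_ZU P X U Z l m"
  unfolding cmean_at_def pi4_W_exp by (simp add: mu_ZU_def cexp_eq pi_W_exp)

lemma centered_tensor_eq:
  "of_bool b *\<^sub>R tensor (x - \<mu>) (x - \<mu>) = of_bool b *\<^sub>R tensor x x
    - tensor (of_bool b *\<^sub>R x) \<mu> - tensor \<mu> (of_bool b *\<^sub>R x) + of_bool b *\<^sub>R tensor \<mu> \<mu>"
  by (simp add: tensor_diff_diff algebra_simps bounded_bilinear.scaleR_left[OF bounded_bilinear_tensor]
      bounded_bilinear.scaleR_right[OF bounded_bilinear_tensor])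

lemma integrable_centered_tensor:
  "integrable P (\<lambda>\<omega>. of_bool (U \<omega> = m) *\<^sub>R tensor (X \<omega> - \<mu>) (X \<omega> - \<mu>))"
  unfolding centered_tensor_eq
  by (intro Bochner_Integration.integrable_add Bochner_Integration.integrable_diff
      integrable_scaleR_left integrable_pi
      integrable_bounded_linear[OF bounded_bilinear.bounded_linear_left[OF bounded_bilinear_tensor]]
      integrable_bounded_linear[OF bounded_bilinear.bounded_linear_right[OF bounded_bilinear_tensor]])

lemma cov_at_W_exp: "cov_at m W_exp = V_U P X U m"
proof -
  let ?\<mu> = "mu_U P X U m" and ?p = "p_U P U m"
  note bil = bounded_bilinear_tensor
  have p: "?p \<noteq> 0"
    using p_U_pos[of m] by simp
  have mean: "pi2 m W_exp = ?p *\<^sub>R ?\<mu>"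
    using p by (simp flip: mean_at_W_exp add: mean_at_def pi3_W_exp)
  have "expectation (\<lambda>\<omega>. of_bool (U \<omega> = m) *\<^sub>R tensor (X \<omega> - ?\<mu>) (X \<omega> - ?\<mu>))
      = pi5 m W_exp - tensor (pi2 m W_exp) ?\<mu> - tensor ?\<mu> (pi2 m W_exp) + pi3 m W_exp *\<^sub>R tensor ?\<mu> ?\<mu>"
    unfolding centered_tensor_eq pi_W_exp
    by (simp add: integrable_pi
      integrable_bounded_linear[OF bounded_bilinear.bounded_linear_left[OF bil]]
      integrable_bounded_linear[OF bounded_bilinear.bounded_linear_right[OF bil]]
      integral_bounded_linear[OF bounded_bilinear.bounded_linear_left[OF bil]]
      integral_bounded_linear[OF bounded_bilinear.bounded_linear_right[OF bil]])
  also have "\<dots> = pi5 m W_exp - ?p *\<^sub>R tensor ?\<mu> ?\<mu>"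
    by (simp add: mean pi3_W_exp bounded_bilinear.scaleR_left[OF bil] bounded_bilinear.scaleR_right[OF bil])
  finally show ?thesis
    using p by (simp add: V_U_def cexp_eq cov_at_def pi3_W_exp mean_at_W_exp scaleR_diff_right
        flip: p_U_def)
qed

text \<open>The quadratic form of \<open>V\<^sub>m\<close> at \<open>x\<close> is the conditional second moment of \<open>\<langle>X - \<mu>\<^sub>m, x\<rangle>\<close>. If it
  vanishes, then so does \<open>\<langle>X - \<mu>\<^sub>m, x\<rangle>\<close> almost surely on \<open>U = m\<close>, and hence \<open>V\<^sub>m x\<close>, which is the
  conditional mean of \<open>\<langle>X - \<mu>\<^sub>m, x\<rangle> (X - \<mu>\<^sub>m)\<close>; this contradicts invertibility.\<close>

lemma V_U_positive_definite:
  assumes "x \<noteq> 0"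
  shows "x \<bullet> (V_U P X U m *v x) > 0"
proof -
  define Y where "Y \<omega> = X \<omega> - mu_U P X U m" for \<omega>
  have int: "integrable P (\<lambda>\<omega>. of_bool (U \<omega> = m) *\<^sub>R tensor (Y \<omega>) (Y \<omega>))"
    unfolding Y_def by (rule integrable_centered_tensor)
  have V: "p_U P U m *\<^sub>R V_U P X U m = expectation (\<lambda>\<omega>. of_bool (U \<omega> = m) *\<^sub>R tensor (Y \<omega>) (Y \<omega>))"
    using p_U_pos[of m] by (simp add: V_U_def cexp_eq Y_def flip: p_U_def)
  have eval: "bounded_linear (\<lambda>A :: real ^ 'p ^ 'p. A *v x)"
    by (rule bounded_bilinear.bounded_linear_left[OF bounded_bilinear_matrix_vector_mult])
  have eval_eq: "(of_bool (U \<omega> = m) *\<^sub>R tensor (Y \<omega>) (Y \<omega>)) *v x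
      = of_bool (U \<omega> = m) *\<^sub>R ((Y \<omega> \<bullet> x) *\<^sub>R Y \<omega>)" for \<omega>
    by (simp add: bounded_bilinear.scaleR_left[OF bounded_bilinear_matrix_vector_mult] tensor_apply)
  have int_x: "integrable P (\<lambda>\<omega>. of_bool (U \<omega> = m) *\<^sub>R ((Y \<omega> \<bullet> x) *\<^sub>R Y \<omega>))"
    using integrable_bounded_linear[OF eval int] by (simp only: eval_eq)
  have V_x: "p_U P U m *\<^sub>R (V_U P X U m *v x)
      = expectation (\<lambda>\<omega>. of_bool (U \<omega> = m) *\<^sub>R ((Y \<omega> \<bullet> x) *\<^sub>R Y \<omega>))"
    unfolding eval_eq[symmetric] integral_bounded_linear[OF eval int] V[symmetric]
    by (simp add: bounded_bilinear.scaleR_left[OF bounded_bilinear_matrix_vector_mult])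
  define f where "f \<omega> = of_bool (U \<omega> = m) * (Y \<omega> \<bullet> x)\<^sup>2" for \<omega>
  have f_eq: "x \<bullet> (of_bool (U \<omega> = m) *\<^sub>R ((Y \<omega> \<bullet> x) *\<^sub>R Y \<omega>)) = f \<omega>" for \<omega>
    by (simp add: f_def power2_eq_square inner_commute)
  have f_int: "integrable P f"
    using integrable_inner_right[OF int_x, of x] by (simp only: f_eq)
  have f_exp: "p_U P U m * (x \<bullet> (V_U P X U m *v x)) = expectation f"
  proof -
    have "p_U P U m * (x \<bullet> (V_U P X U m *v x))
        = x \<bullet> expectation (\<lambda>\<omega>. of_bool (U \<omega> = m) *\<^sub>R ((Y \<omega> \<bullet> x) *\<^sub>R Y \<omega>))"
      by (simp only: inner_scaleR_right flip: V_x)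
    also have "\<dots> = expectation (\<lambda>\<omega>. x \<bullet> (of_bool (U \<omega> = m) *\<^sub>R ((Y \<omega> \<bullet> x) *\<^sub>R Y \<omega>)))"
      by (rule integral_inner_right[symmetric]) (rule int_x)
    finally show ?thesis
      by (simp only: f_eq)
  qed
  have "expectation f \<noteq> 0"
  proof
    assume "expectation f = 0"
    then have "AE \<omega> in P. f \<omega> = 0"
      using integral_nonneg_eq_0_iff_AE[OF f_int] by (simp add: f_def)
    then have "AE \<omega> in P. of_bool (U \<omega> = m) *\<^sub>R ((Y \<omega> \<bullet> x) *\<^sub>R Y \<omega>) = 0"
      by eventually_elim (auto simp: f_def)
    then have "expectation (\<lambda>\<omega>. of_bool (U \<omega> = m) *\<^sub>R ((Y \<omega> \<bullet> x) *\<^sub>R Y \<omega>)) = 0"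
      by (rule integral_eq_zero_AE)
    then have "V_U P X U m *v x = 0"
      using V_x p_U_pos[of m] by simp
    then show False
      using inj_matrix_vector_mult[OF V_inv, THEN injD, of m x 0] assms by simp
  qed
  moreover have "expectation f \<ge> 0"
    by (rule integral_nonneg_AE) (simp add: f_def)
  ultimately show ?thesis
    using f_exp p_U_pos[of m] by (metis less_eq_real_def zero_less_mult_pos)
qed

lemma regular_at_W_exp: "regular_at K W_exp"
  unfolding regular_at_def cov_at_W_exp
  using p_U_pos p_ZU_pos invertible_padded_if_positive_definite[OF V_U_positive_definite]
  by (simp add: pi3_W_exp pi4_W_exp_factor less_imp_neq[symmetric])

lemma Q_op_V_U: "Q_op K (V_U P X U m) = Q_padded K (V_U P X U m)"
  using regular_at_W_exp[of K]
  by (intro Q_op_eq_Q_padded) (simp add: regular_at_def cov_at_W_exp compress_invertible_iff)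

lemma resid_at_W_exp: "resid_at K m W_exp = mat 1 - V_U P X U m ** Q_op K (V_U P X U m)"
  by (simp add: resid_at_def cov_at_W_exp Q_op_V_U)

lemma Delta_at_W_exp: "Delta_at K l m W_exp = Delta P X U Z K l m"
  by (simp add: Delta_at_def Delta_def resid_at_W_exp cmean_at_W_exp mean_at_W_exp)

lemma xi_at_W_exp: "xi_at K m W_exp = xi_cond P X U Z K m"
  by (simp add: xi_at_def xi_cond_def Delta_at_W_exp Delta_def cprob_at_W_exp)

lemma xi_eq: "xi P X U Z K = (\<Sum>m\<in>UNIV. (pi3 m W_exp)\<^sup>2 * xi_at K m W_exp)"
  by (simp add: xi_def pi3_W_exp xi_at_W_exp)

lemma Lambda_at_W_exp: "Lambda_at K m W_exp W_exp = Lambda_op P X U Z K m"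
  by (simp add: fun_eq_iff Lambda_at_def Lambda_op_def pi3_W_exp xi_at_W_exp)

lemma Phi_at_W_exp: "Phi_at K l m W_exp W_exp = Phi_op P X U Z K l m"
  by (simp add: fun_eq_iff Phi_at_def Phi_op_def pi3_W_exp cprob_at_W_exp Delta_at_W_exp)

lemma Psi_at_W_exp: "Psi_at K l m W_exp W_exp = Psi_op P X U Z K l m"
proof
  fix T :: "('p, 'l, 'm) E_space"
  define R where "R = mat 1 - V_U P X U m ** Q_op K (V_U P X U m)"
  define A1 where "A1 = (pi5 m T - pi3 m T *\<^sub>R
      (V_U P X U m + tensor (mu_U P X U m) (mu_U P X U m))) ** Q_op K (V_U P X U m)"
  define A2 where "A2 = tensor (pi2 m T - pi3 m T *\<^sub>R mu_U P X U m) (mu_U P X U m)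
      ** Q_op K (V_U P X U m)"
  define A3 where "A3 = tensor (mu_U P X U m) (pi2 m T - pi3 m T *\<^sub>R mu_U P X U m)
      ** Q_op K (V_U P X U m)"
  define \<delta> where "\<delta> = mu_ZU P X U Z l m - mu_U P X U m"
  have "Psi_op P X U Z K l m T = R *v (inverse (p_U P U m) *\<^sub>R
      (inverse (p_ZU P U Z l m) *\<^sub>R (pi1 l m T - pi4 l m T *\<^sub>R mu_ZU P X U Z l m)
       - pi2 m T + pi3 m T *\<^sub>R mu_U P X U m - A1 *v \<delta> + A2 *v \<delta> + A3 *v \<delta>))"
    by (simp only: Psi_op_def Let_def R_def A1_def A2_def A3_def \<delta>_def
        bounded_bilinear.scaleR_right[OF bounded_bilinear_matrix_vector_mult])
  also have "\<dots> = R *v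
      (inverse (p_U P U m * p_ZU P U Z l m) *\<^sub>R (pi1 l m T - pi4 l m T *\<^sub>R mu_ZU P X U Z l m)
       - inverse (p_U P U m) *\<^sub>R (pi2 m T - pi3 m T *\<^sub>R mu_U P X U m)
       - inverse (p_U P U m) *\<^sub>R (A1 *v \<delta>)
       + inverse (p_U P U m) *\<^sub>R (A2 *v \<delta>) + inverse (p_U P U m) *\<^sub>R (A3 *v \<delta>))"
    by (simp add: algebra_simps)
  also have "\<dots> = Psi_at K l m W_exp W_exp T"
    by (simp only: Psi_at_def Let_def pi3_W_exp pi4_W_exp_factor cmean_at_W_exp mean_at_W_exp
        cov_at_W_exp resid_at_W_exp Q_op_V_U[symmetric] matrix_vector_mul_assoc
        R_def A1_def A2_def A3_def \<delta>_def)
  finally show "Psi_at K l m W_exp W_exp T = Psi_op P X U Z K l m T" ..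
qed

end

section \<open>Consistency and the decomposition of the criterion\<close>

theorem theorem1:
  fixes P :: "'a measure"
    and X :: "'a \<Rightarrow> real ^ 'p"
    and Y :: "'a \<Rightarrow> bool ^ ('d::finite) idx"
    and Z :: "'a \<Rightarrow> ('q::finite) idx"
    and U :: "'a \<Rightarrow> 'd set idx"
    and Xs :: "nat \<Rightarrow> 'a \<Rightarrow> real ^ 'p"
    and Ys :: "nat \<Rightarrow> 'a \<Rightarrow> bool ^ 'd idx"
    and Zs :: "nat \<Rightarrow> 'a \<Rightarrow> 'q idx"
    and Us :: "nat \<Rightarrow> 'a \<Rightarrow> 'd set idx"
    and K :: "'p set"
  assumes prob: "prob_space P"
    and X_meas: "X \<in> borel_measurable P"
    and Y_meas: "Y \<in> measurable P (count_space UNIV)"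
    and Z_meas: "Z \<in> measurable P (count_space UNIV)"
    and q_ge_2: "CARD('q) \<ge> 2"
    and X_moment: "integrable P (\<lambda>\<omega>. norm (X \<omega>) ^ 4)"
    and U_eq: "\<And>\<omega>. U \<omega> = level (Y \<omega>)"
    and p_U_pos: "\<And>m. p_U P U m > 0"
    and p_ZU_pos: "\<And>l m. p_ZU P U Z l m > 0"
    and V_inv: "\<And>m. invertible (V_U P X U m)"
    and sample_indep:
      "prob_space.indep_vars P
        (\<lambda>_. borel \<Otimes>\<^sub>M count_space UNIV \<Otimes>\<^sub>M count_space UNIV)
        (\<lambda>i \<omega>. (Xs i \<omega>, Ys i \<omega>, Zs i \<omega>)) {1..}"
    and sample_distr:
      "\<And>i. i \<ge> 1 \<Longrightarrow>
        distr P (borel \<Otimes>\<^sub>M count_space UNIV \<Otimes>\<^sub>M count_space UNIV)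
          (\<lambda>\<omega>. (Xs i \<omega>, Ys i \<omega>, Zs i \<omega>)) =
        distr P (borel \<Otimes>\<^sub>M count_space UNIV \<Otimes>\<^sub>M count_space UNIV)
          (\<lambda>\<omega>. (X \<omega>, Y \<omega>, Z \<omega>))"
    and Us_eq: "\<And>i \<omega>. Us i \<omega> = level (Ys i \<omega>)"
  shows
    "(AE \<omega> in P.
        (\<forall>\<^sub>F n in sequentially. estimators_defined n (\<lambda>i. Xs i \<omega>) (\<lambda>i. Us i \<omega>) (\<lambda>i. Zs i \<omega>) K) \<and>
        (\<lambda>n. xi_hat n (\<lambda>i. Xs i \<omega>) (\<lambda>i. Us i \<omega>) (\<lambda>i. Zs i \<omega>) K) \<longlonglongrightarrow> xi P X U Z K)
     \<and>
     (\<exists>(Lh :: 'd set idx \<Rightarrow> nat \<Rightarrow> 'a \<Rightarrow> ('p, 'q idx, 'd set idx) E_space \<Rightarrow> real)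
       (Ph :: 'q idx \<Rightarrow> 'd set idx \<Rightarrow> nat \<Rightarrow> 'a \<Rightarrow> ('p, 'q idx, 'd set idx) E_space \<Rightarrow> real)
       (Sh :: 'q idx \<Rightarrow> 'd set idx \<Rightarrow> nat \<Rightarrow> 'a \<Rightarrow> ('p, 'q idx, 'd set idx) E_space \<Rightarrow> real ^ 'p).
        (\<forall>n\<ge>1. \<forall>m. random_operator P (Lh m n)) \<and>
        (\<forall>n\<ge>1. \<forall>l m. random_operator P (Ph l m n)) \<and>
        (\<forall>n\<ge>1. \<forall>l m. random_operator P (Sh l m n)) \<and>
        (\<forall>m. as_uniformly_converges P (Lh m) (Lambda_op P X U Z K m)) \<and>
        (\<forall>l m. as_uniformly_converges P (Ph l m) (Phi_op P X U Z K l m)) \<and>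
        (\<forall>l m. as_uniformly_converges P (Sh l m) (Psi_op P X U Z K l m)) \<and>
        (\<forall>n\<ge>1. \<forall>\<omega>\<in>space P.
          estimators_defined n (\<lambda>i. Xs i \<omega>) (\<lambda>i. Us i \<omega>) (\<lambda>i. Zs i \<omega>) K \<longrightarrow>
          (let Wn = W_hat P X U Z n (\<lambda>i. Xs i \<omega>) (\<lambda>i. Us i \<omega>) (\<lambda>i. Zs i \<omega>) in
           real n * xi_hat n (\<lambda>i. Xs i \<omega>) (\<lambda>i. Us i \<omega>) (\<lambda>i. Zs i \<omega>) K =
             (\<Sum>m\<in>UNIV. sqrt (real n) * Lh m n \<omega> Wn) +
             (\<Sum>m\<in>UNIV. \<Sum>l\<in>UNIV.
               (p_U P U m * Ph l m n \<omega> Wn +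
                p_U P U m * p_ZU P U Z l m *
                  norm (Sh l m n \<omega> Wn + sqrt (real n) *\<^sub>R Delta P X U Z K l m))\<^sup>2))))"
proof -
  interpret prob_space P by (rule prob)
  have U_meas: "U \<in> measurable P (count_space UNIV)"
  proof -
    have "(\<lambda>\<omega>. level (Y \<omega>)) \<in> measurable P (count_space UNIV)"
      using Y_meas by (rule measurable_compose) simp
    moreover have "U = (\<lambda>\<omega>. level (Y \<omega>))"
      by (rule ext) (rule U_eq)
    ultimately show ?thesis by simp
  qed
  interpret sampling_model P X U Z
    by unfold_locales (fact X_meas U_meas Z_meas X_moment p_U_pos p_ZU_pos V_inv)+
  define N where "N = (borel :: (real ^ 'p) measure) \<Otimes>\<^sub>M
    (count_space UNIV :: (bool ^ 'd idx) measure) \<Otimes>\<^sub>M (count_space UNIV :: 'q idx measure)"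
  define g :: "(real ^ 'p) \<times> (bool ^ 'd idx) \<times> 'q idx \<Rightarrow> ('p, 'q idx, 'd set idx) E_space"
    where "g = (\<lambda>(x, y, z). W_of x (level y) z)"
  define W where "W n \<omega> = W_mean n (\<lambda>i. Xs i \<omega>) (\<lambda>i. Us i \<omega>) (\<lambda>i. Zs i \<omega>)" for n \<omega>
  have g_meas [measurable]: "g \<in> borel_measurable N"
  proof -
    have [measurable]: "level \<in> measurable (count_space UNIV :: (bool ^ 'd idx) measure) (count_space UNIV)"
      by simp
    show ?thesis
      unfolding g_def case_prod_beta N_def by (rule borel_measurable_W_of) measurable
  qed
  have W_eq: "W n \<omega> = (1 / real n) *\<^sub>R (\<Sum>i=1..n. g (Xs i \<omega>, Ys i \<omega>, Zs i \<omega>))" for n \<omega>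
    by (simp add: W_def W_mean_def g_def Us_eq)
  have W_exp_eq: "W_exp = expectation (\<lambda>\<omega>. g (X \<omega>, Y \<omega>, Z \<omega>))"
    by (simp add: W_exp_def g_def U_eq)
  have sample_meas: "(\<lambda>\<omega>. (Xs i \<omega>, Ys i \<omega>, Zs i \<omega>)) \<in> measurable P N" if "1 \<le> i" for i
    using sample_indep that by (auto simp: indep_vars_def N_def)
  have W_meas: "W n \<in> borel_measurable P" for n
    unfolding W_eq[abs_def]
    by (intro borel_measurable_scaleR borel_measurable_const borel_measurable_sum
        measurable_compose[OF sample_meas g_meas]) simp
  have lim: "AE \<omega> in P. (\<lambda>n. W n \<omega>) \<longlonglongrightarrow> W_exp"
    unfolding W_eq W_exp_eq
  proof (rule strong_law_iid_euclidean[where N = N and g = g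
        and \<xi> = "\<lambda>i \<omega>. (Xs i \<omega>, Ys i \<omega>, Zs i \<omega>)" and \<eta> = "\<lambda>\<omega>. (X \<omega>, Y \<omega>, Z \<omega>)"])
    show "indep_vars (\<lambda>_. N) (\<lambda>i \<omega>. (Xs i \<omega>, Ys i \<omega>, Zs i \<omega>)) {1..}"
      unfolding N_def by (rule sample_indep)
    show "distr P N (\<lambda>\<omega>. (Xs i \<omega>, Ys i \<omega>, Zs i \<omega>)) = distr P N (\<lambda>\<omega>. (X \<omega>, Y \<omega>, Z \<omega>))"
      if "1 \<le> i" for i
      unfolding N_def using that by (rule sample_distr)
    show "(\<lambda>\<omega>. (X \<omega>, Y \<omega>, Z \<omega>)) \<in> measurable P N"
      unfolding N_def using X_meas Y_meas Z_meas by measurable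
    show "g \<in> borel_measurable N"
      by (rule g_meas)
    show "integrable P (\<lambda>\<omega>. (norm (g (X \<omega>, Y \<omega>, Z \<omega>)))\<^sup>2)"
      using square_integrable_W_of[OF X_meas U_meas Z_meas X_moment] by (simp add: g_def U_eq)
  qed
  let ?defined = "\<lambda>n \<omega>. estimators_defined n (\<lambda>i. Xs i \<omega>) (\<lambda>i. Us i \<omega>) (\<lambda>i. Zs i \<omega>) K"
  let ?xi = "\<lambda>n \<omega>. xi_hat n (\<lambda>i. Xs i \<omega>) (\<lambda>i. Us i \<omega>) (\<lambda>i. Zs i \<omega>) K"
  have xi_W: "?xi n \<omega> = (\<Sum>m\<in>UNIV. (pi3 m (W n \<omega>))\<^sup>2 * xi_at K m (W n \<omega>))" if "?defined n \<omega>" for n \<omega>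
    using xi_hat_eq[OF that] by (simp add: W_def)
  have consistent: "AE \<omega> in P. (\<forall>\<^sub>F n in sequentially. ?defined n \<omega>) \<and> (\<lambda>n. ?xi n \<omega>) \<longlonglongrightarrow> xi P X U Z K"
    using lim
  proof eventually_elim
    case (elim \<omega>)
    have defined: "\<forall>\<^sub>F n in sequentially. ?defined n \<omega>"
      using eventually_regular_at[OF elim regular_at_W_exp[of K]] eventually_gt_at_top[of 0]
      by eventually_elim (simp add: estimators_defined_iff W_def)
    have "(\<lambda>n. \<Sum>m\<in>UNIV. (pi3 m (W n \<omega>))\<^sup>2 * xi_at K m (W n \<omega>)) \<longlonglongrightarrow> xi P X U Z K"
      unfolding xi_eq by (intro tendsto_intros tendsto_pi elim tendsto_xi_at[OF elim regular_at_W_exp])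
    moreover have "\<forall>\<^sub>F n in sequentially.
        (\<Sum>m\<in>UNIV. (pi3 m (W n \<omega>))\<^sup>2 * xi_at K m (W n \<omega>)) = ?xi n \<omega>"
      using defined by eventually_elim (rule xi_W[symmetric])
    ultimately have "(\<lambda>n. ?xi n \<omega>) \<longlonglongrightarrow> xi P X U Z K"
      by (rule Lim_transform_eventually)
    with defined show ?case ..
  qed
  have converges: "as_uniformly_converges P (\<lambda>n \<omega>. L (W n \<omega>)) (L W_exp)"
    if "\<And>w. linear (L w)" and "\<And>f T. f \<longlonglongrightarrow> W_exp \<Longrightarrow> (\<lambda>n. L (f n) T) \<longlonglongrightarrow> L W_exp T"
    for L :: "('p, 'q idx, 'd set idx) E_space \<Rightarrow> ('p, 'q idx, 'd set idx) E_space \<Rightarrow> 'c::euclidean_space"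
    unfolding as_uniformly_converges_def using lim
  proof eventually_elim
    case (elim \<omega>)
    show ?case
      by (intro onorm_tendsto_zero_if_pointwise linear_compose_sub that(1) LIM_zero that(2) elim)
  qed
  have identity: "real n * ?xi n \<omega> =
      (\<Sum>m\<in>UNIV. sqrt (real n) * Lambda_at K m W_exp (W n \<omega>) T) +
      (\<Sum>m\<in>UNIV. \<Sum>l\<in>UNIV. (p_U P U m * Phi_at K l m W_exp (W n \<omega>) T +
         p_U P U m * p_ZU P U Z l m *
           norm (Psi_at K l m W_exp (W n \<omega>) T + sqrt (real n) *\<^sub>R Delta P X U Z K l m))\<^sup>2)"
    if n: "1 \<le> n" and defined: "?defined n \<omega>"
      and T: "T = W_hat P X U Z n (\<lambda>i. Xs i \<omega>) (\<lambda>i. Us i \<omega>) (\<lambda>i. Zs i \<omega>)" for n \<omega> T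
  proof -
    have "T = sqrt (real n) *\<^sub>R (W n \<omega> - W_exp)"
      by (simp add: T W_hat_def W_def W_mean_def W_exp_def)
    moreover have "regular_at K (W n \<omega>)"
      using defined n by (simp add: W_def estimators_defined_iff)
    ultimately show ?thesis
      using xi_at_decomposition[OF _ regular_at_W_exp, of K "W n \<omega>" "sqrt (real n)"]
      by (simp add: xi_W[OF defined] pi3_W_exp cprob_at_W_exp Delta_at_W_exp)
  qed
  have random: "random_operator P (\<lambda>\<omega>. Lambda_at K m W_exp (W n \<omega>))"
    "random_operator P (\<lambda>\<omega>. Phi_at K l m W_exp (W n \<omega>))"
    "random_operator P (\<lambda>\<omega>. Psi_at K l m W_exp (W n \<omega>))" for n l m
    by (simp_all add: random_operator_def linear_Lambda_at linear_Phi_at linear_Psi_at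
        borel_measurable_operators_at[OF W_meas])
  have Lambda: "as_uniformly_converges P (\<lambda>n \<omega>. Lambda_at K m W_exp (W n \<omega>)) (Lambda_op P X U Z K m)"
    for m
    unfolding Lambda_at_W_exp[symmetric]
    by (rule converges[of "Lambda_at K m W_exp", OF linear_Lambda_at
          tendsto_Lambda_at[OF _ regular_at_W_exp]])
  have Phi: "as_uniformly_converges P (\<lambda>n \<omega>. Phi_at K l m W_exp (W n \<omega>)) (Phi_op P X U Z K l m)"
    for l m
    unfolding Phi_at_W_exp[symmetric]
    by (rule converges[of "Phi_at K l m W_exp", OF linear_Phi_at
          tendsto_Phi_at[OF _ regular_at_W_exp]])
  have Psi: "as_uniformly_converges P (\<lambda>n \<omega>. Psi_at K l m W_exp (W n \<omega>)) (Psi_op P X U Z K l m)"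
    for l m
    unfolding Psi_at_W_exp[symmetric]
    by (rule converges[of "Psi_at K l m W_exp", OF linear_Psi_at
          tendsto_Psi_at[OF _ regular_at_W_exp]])
  show ?thesis
    unfolding Let_def
    by (rule conjI[OF consistent], rule exI[of _ "\<lambda>m n \<omega>. Lambda_at K m W_exp (W n \<omega>)"],
        rule exI[of _ "\<lambda>l m n \<omega>. Phi_at K l m W_exp (W n \<omega>)"],
        rule exI[of _ "\<lambda>l m n \<omega>. Psi_at K l m W_exp (W n \<omega>)"],
        intro conjI allI impI ballI random Lambda Phi Psi identity[OF _ _ refl])
qed

end
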